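(* Fix constants $\beta>1$, $\varepsilon\in(0,1)$, $\omega>1$, $\omega'>1$ and an integer $K^*\ge3$. There exist constants $c,C_0>0$ depending only on $\beta,\varepsilon,K^*,\omega,\omega'$ such that the following holds. Let $n,K$ be positive integers with $3\le K\le K^*$, let $p^*\in(0,1-\varepsilon]$ with $np^*\ge C_0$, and let $D^*$ be such that there exists $q$ with $0<q<p^*$, $\omega'\le p^*/q\le\omega$ and $$D^*=D_{\alpha^*}\big(\mathrm{Bin}(\lfloor n/K\rfloor,p^* )\,\big\|\,\mathrm{Bin}(\lfloor n/K\rfloor,q)\big).$$ Then, with $\mathcal S=\mathcal S(n,p^*,K,D^* )$ the class of stochastic block model parameters $(z,P)$ defined in the context, $$\inf_{\hat z}\ \sup_{(z,P)\in\mathcal S}\ \mathbb E[\mathrm{Mis}(\hat z,z)]\ \ge\ \frac{c}{\sqrt{np^*}}\,e^{-D^*},$$ where the infimum is over all estimators $\hat z=\hat z(A)\in[K]^n$ based on the adjacency matrix $A$ (with $K$ known), and the expectation is over $A$ drawn from the stochastic block model with parameters $(z,P)$.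
   Context: Stochastic block model (SBM): given labels $z\in[K]^n$ and a symmetric $P\in(0,1)^{K\times K}$, the adjacency matrix $A\in\{0,1\}^{n\times n}$ is symmetric with $A_{ii}=0$ and $A_{ij}=A_{ji}\sim\mathrm{Bern}(P_{z_iz_j})$ independently for $i>j$. Put $n_k=|\{i:z_i=k\}|$ and $p_{kj}=P_{kz_j}$ for $k\in[K]$, $j\in[n]$, $p_{k*}=(p_{k1},\dots,p_{kn})$. Misclassification rate: $\mathrm{Mis}(\hat z,z)=\min_{\pi\in S_K}\frac1n\sum_{i=1}^n1\{\pi(\hat z_i)\ne z_i\}$, with $S_K$ the group of permutations of $[K]$. Chernoff information: for two probability mass functions $\varphi_0,\varphi_1$, $D_{\alpha^*}(\varphi_0\|\varphi_1)=\sup_{\alpha\in(0,1)}\big(-\log\sum_x\varphi_0(x)^{1-\alpha}\varphi_1(x)^\alpha\big)$ (the symbol $\alpha^*$ denotes the maximizer, which depends on the pair). For vectors, $D_{\alpha^*}(p_{k*}\|p_{\ell*})$ is the Chernoff information between $\bigotimes_{j=1}^n\mathrm{Bern}(p_{kj})$ and $\bigotimes_{j=1}^n\mathrm{Bern}(p_{\ell j})$. The parameter class $\mathcal S(n,p^*,K,D^* )$ is the set of pairs $(z,P)$ with $z\in[K]^n$, $P\in(0,1)^{K\times K}$, $P=P^\top$, such that: $n_k\in[\frac{n}{\beta K},\frac{\beta n}{K}]$ for all $k$; $\max_{k,\ell}P_{k\ell}=p^*\le1-\varepsilon$; $\max_{k,\ell}P_{k\ell}/\min_{k',\ell'}P_{k'\ell'}\le\omega$;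 $\min_{k\ne\ell}\max_{r\in[K]}\max\big(\frac{P_{kr}}{P_{\ell r}},\frac{P_{\ell r}}{P_{kr}}\big)\ge\omega'$; and $\min_{k\ne\ell}D_{\alpha^*}(p_{k*}\|p_{\ell*})\ge D^*$. *)

theory Defs
  imports "HOL-Probability.Probability"
begin

definition labelings :: "nat \<Rightarrow> nat \<Rightarrow> (nat \<Rightarrow> nat) set" where
  "labelings n K = ({1..n} \<rightarrow>\<^sub>E {1..K})"

text \<open>Matrices are functions on all of \<open>nat \<times> nat\<close>; adjacency matrices are 0 outside
  \<open>{1..n} \<times> {1..n}\<close>.\<close>

definition adjacency_matrices :: "nat \<Rightarrow> (nat \<Rightarrow> nat \<Rightarrow> nat) set" where
  "adjacency_matrices n =
     {A. (\<forall>i j. A i j \<in> {0, 1}) \<and> (\<forall>i j. A i j = A j i) \<and> (\<forall>i. A i i = 0) \<and>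
         (\<forall>i j. i \<notin> {1..n} \<or> j \<notin> {1..n} \<longrightarrow> A i j = 0)}"

text \<open>The edge indicators \<open>X (i, j)\<close>, \<open>i > j\<close>, are independent; \<open>X\<close> is \<open>False\<close> outside the
  index set, in particular on the diagonal.\<close>

definition sbm :: "nat \<Rightarrow> (nat \<Rightarrow> nat) \<Rightarrow> (nat \<Rightarrow> nat \<Rightarrow> real) \<Rightarrow> (nat \<Rightarrow> nat \<Rightarrow> nat) pmf" where
  "sbm n z P =
     map_pmf (\<lambda>X i j. of_bool (if i > j then X (i, j) else X (j, i)))
       (Pi_pmf {(i, j). i \<in> {1..n} \<and> j \<in> {1..n} \<and> i > j} False
          (\<lambda>(i, j). bernoulli_pmf (P (z i) (z j))))"

definition Mis :: "nat \<Rightarrow> nat \<Rightarrow> (nat \<Rightarrow> nat) \<Rightarrow> (nat \<Rightarrow> nat) \<Rightarrow> real" where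
  "Mis n K zh z =
     (MIN \<pi>\<in>{\<pi>. \<pi> permutes {1..K}}. 1 / real n * (\<Sum>i=1..n. of_bool (\<pi> (zh i) \<noteq> z i)))"

text \<open>The case distinction is the convention \<open>- log 0 = \<infinity>\<close> (disjoint supports);
  Isabelle has \<open>ln 0 = 0\<close>.\<close>

definition chernoff :: "'a pmf \<Rightarrow> 'a pmf \<Rightarrow> ereal" where
  "chernoff \<phi>0 \<phi>1 =
     (SUP \<alpha>\<in>{0<..<1::real}.
        let s = (\<Sum>\<^sub>\<infinity>x. pmf \<phi>0 x powr (1 - \<alpha>) * pmf \<phi>1 x powr \<alpha>)
        in if s = 0 then \<infinity> else ereal (- ln s))"

definition bernoulli_product :: "nat \<Rightarrow> (nat \<Rightarrow> real) \<Rightarrow> (nat \<Rightarrow> bool) pmf" where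
  "bernoulli_product n p = Pi_pmf {1..n} False (\<lambda>j. bernoulli_pmf (p j))"

definition chernoff_vec :: "nat \<Rightarrow> (nat \<Rightarrow> real) \<Rightarrow> (nat \<Rightarrow> real) \<Rightarrow> ereal" where
  "chernoff_vec n p p' = chernoff (bernoulli_product n p) (bernoulli_product n p')"

text \<open>Only the entries of \<open>P\<close> on \<open>{1..K} \<times> {1..K}\<close> matter; the others are unconstrained.\<close>

definition sbm_class ::
  "real \<Rightarrow> real \<Rightarrow> real \<Rightarrow> real \<Rightarrow> nat \<Rightarrow> real \<Rightarrow> nat \<Rightarrow> real
     \<Rightarrow> ((nat \<Rightarrow> nat) \<times> (nat \<Rightarrow> nat \<Rightarrow> real)) set" where
  "sbm_class \<beta> \<epsilon> \<omega> \<omega>' n pstar K D =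
     {(z, P).
        z \<in> labelings n K \<and>
        (\<forall>k\<in>{1..K}. \<forall>l\<in>{1..K}. P k l \<in> {0<..<1}) \<and>
        (\<forall>k\<in>{1..K}. \<forall>l\<in>{1..K}. P k l = P l k) \<and>
        (\<forall>k\<in>{1..K}. real (card {i\<in>{1..n}. z i = k})
                       \<in> {real n / (\<beta> * real K)..\<beta> * real n / real K}) \<and>
        (MAX (k, l)\<in>{1..K} \<times> {1..K}. P k l) = pstar \<and>
        pstar \<le> 1 - \<epsilon> \<and>
        (MAX (k, l)\<in>{1..K} \<times> {1..K}. P k l) / (MIN (k, l)\<in>{1..K} \<times> {1..K}. P k l) \<le> \<omega> \<and>
        (\<forall>k\<in>{1..K}. \<forall>l\<in>{1..K}. k \<noteq> l \<longrightarrow>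
           (MAX r\<in>{1..K}. max (P k r / P l r) (P l r / P k r)) \<ge> \<omega>') \<and>
        (\<forall>k\<in>{1..K}. \<forall>l\<in>{1..K}. k \<noteq> l \<longrightarrow>
           chernoff_vec n (\<lambda>j. P k (z j)) (\<lambda>j. P l (z j)) \<ge> ereal D)}"

text \<open>Taken in \<open>ereal\<close>, so that the infimum and supremum are the genuine ones
  (in particular the supremum over an empty class is \<open>-\<infinity>\<close>).\<close>

definition minimax_risk ::
  "nat \<Rightarrow> nat \<Rightarrow> ((nat \<Rightarrow> nat) \<times> (nat \<Rightarrow> nat \<Rightarrow> real)) set \<Rightarrow> ereal" where
  "minimax_risk n K S =
     (INF zhat\<in>adjacency_matrices n \<rightarrow> labelings n K.
        SUP (z, P)\<in>S. ereal (measure_pmf.expectation (sbm n z P) (\<lambda>A. Mis n K (zhat A) z)))"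

end

theory Submission imports Defs begin

text \<open>Take the connectivity matrix with entry \<open>p\<close> at \<open>(k, l)\<close> if \<open>k + l \<le> K + 1\<close> and \<open>q\<close> otherwise.
  Its rows \<open>1\<close> and \<open>2\<close> differ in the last column only, so if class \<open>K\<close> has exactly \<open>n div K\<close>
  members, then deciding between the labels \<open>1\<close> and \<open>2\<close> for one node is the problem of testing
  \<open>Bin(n div K, p)\<close> against \<open>Bin(n div K, q)\<close>, while all other classes stay at Chernoff
  information at least \<open>D\<close> from each other. Averaging over all labelings of a pool of linearly
  many nodes by \<open>1\<close> and \<open>2\<close>, the other labels being fixed, bounds the risk from below by a constant
  times the sum of errors of this test. For the latter a single outcome suffices: the mode of the
  tilted binomial distribution for which the log-likelihood ratio is centred has probability of
  order at least \<open>1 / sqrt (n p)\<close> by Chebyshev's inequality, the likelihood ratio is bounded there,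
  and the tilting factor is at least \<open>exp (- D)\<close>.\<close>

section \<open>Mode and variance of the binomial distribution\<close>

text \<open>The ratio of neighbouring binomial weights, cross-multiplied to avoid division; it
  follows from the two absorption identities for binomial coefficients.\<close>

lemma Bernstein_Suc:
  assumes "t < m"
  shows "Bernstein m (Suc t) r * (real (Suc t) * (1 - r)) = Bernstein m t r * (real (m - t) * r)"
proof -
  have "Suc t * (m choose Suc t) = (m - t) * (m choose t)"
    using assms by (metis binomial_absorb_comp binomial_absorption)
  then have c: "real (Suc t) * real (m choose Suc t) = real (m - t) * real (m choose t)"
    by (metis of_nat_mult)
  have e: "(1 - r) ^ (m - t) = (1 - r) * (1 - r) ^ (m - Suc t)"
    using assms by (metis Suc_diff_Suc power_Suc)
  have "Bernstein m (Suc t) r * (real (Suc t) * (1 - r)) =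
      (real (Suc t) * real (m choose Suc t)) * r * r ^ t * ((1 - r) * (1 - r) ^ (m - Suc t))"
    unfolding Bernstein_def by simp
  also have "\<dots> = Bernstein m t r * (real (m - t) * r)"
    unfolding c Bernstein_def e[symmetric] by simp
  finally show ?thesis .
qed

text \<open>Neighbouring weights increase as long as \<open>Suc t \<le> (m + 1) * r\<close> and
  decrease afterwards, so the floor of \<open>(m + 1) * r\<close> is a mode.\<close>

lemma Bernstein_le_mode:
  fixes r :: real
  assumes r: "0 < r" "r < 1"
  obtains t0 where "t0 \<le> m" "\<bar>real t0 - real m * r\<bar> \<le> 1"
    "\<And>t. t \<le> m \<Longrightarrow> Bernstein m t r \<le> Bernstein m t0 r"
proof -
  define t0 where "t0 = nat \<lfloor>real (m + 1) * r\<rfloor>"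
  have nn: "0 \<le> real (m + 1) * r" using r by simp
  have t0: "real t0 \<le> real (m + 1) * r" "real (m + 1) * r < real t0 + 1"
    unfolding t0_def using nn by linarith+
  have "real (m + 1) * r < real (m + 1)" using r by simp
  then have "t0 \<le> m" using t0(1) by linarith
  have up: "Bernstein m t r \<le> Bernstein m (Suc t) r" if "Suc t \<le> t0" for t
  proof -
    have "real (Suc t) \<le> real (m + 1) * r" using that t0 by linarith
    then have le: "real (Suc t) * (1 - r) \<le> real (m - t) * r"
      using that \<open>t0 \<le> m\<close> by (simp add: of_nat_diff algebra_simps)
    have "Bernstein m t r * (real (Suc t) * (1 - r)) \<le> Bernstein m t r * (real (m - t) * r)"
      using le r by (intro mult_left_mono Bernstein_nonneg) auto
    also have "\<dots> = Bernstein m (Suc t) r * (real (Suc t) * (1 - r))"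
      using that \<open>t0 \<le> m\<close> by (intro Bernstein_Suc[symmetric]) simp
    finally show ?thesis using r by simp
  qed
  have down: "Bernstein m (Suc t) r \<le> Bernstein m t r" if "t0 \<le> t" "t < m" for t
  proof -
    have "real (m + 1) * r \<le> real (Suc t)" using that t0 by linarith
    then have le: "real (m - t) * r \<le> real (Suc t) * (1 - r)"
      using that by (simp add: of_nat_diff algebra_simps)
    have "Bernstein m (Suc t) r * (real (Suc t) * (1 - r)) = Bernstein m t r * (real (m - t) * r)"
      using that by (intro Bernstein_Suc)
    also have "\<dots> \<le> Bernstein m t r * (real (Suc t) * (1 - r))"
      using le r by (intro mult_left_mono Bernstein_nonneg) auto
    finally show ?thesis using r by simp
  qed
  have "Bernstein m t r \<le> Bernstein m t0 r" if "t \<le> m" for t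
  proof (cases "t \<le> t0")
    case True
    then show ?thesis
    proof (induction t rule: inc_induct)
      case (step t)
      then show ?case using up[of t] by simp
    qed simp
  next
    case False
    then have "t0 \<le> t" by simp
    then show ?thesis using that
    proof (induction t rule: dec_induct)
      case (step t)
      then show ?case using down[of t] by simp
    qed simp
  qed
  moreover have "\<bar>real t0 - real m * r\<bar> \<le> 1"
    using t0 r unfolding abs_le_iff by (simp add: algebra_simps)
  ultimately show ?thesis using that \<open>t0 \<le> m\<close> by blast
qed

text \<open>Expand the square as \<open>t * (t - 1) + (1 - 2 * m * x) * t\<close> plus the constant
  \<open>(m * x)\<^sup>2\<close>, then insert the known factorial moment, mean and total
  mass.\<close>

lemma Bernstein_variance:
  "(\<Sum>t\<le>m. (real t - real m * x)\<^sup>2 * Bernstein m t x) = real m * x * (1 - x)"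
proof -
  have "(\<Sum>t\<le>m. (real t - real m * x)\<^sup>2 * Bernstein m t x) =
      (\<Sum>t\<le>m. real t * (real t - 1) * Bernstein m t x) +
      (1 - 2 * real m * x) * (\<Sum>t\<le>m. real t * Bernstein m t x) +
      (real m * x)\<^sup>2 * (\<Sum>t\<le>m. Bernstein m t x)"
    unfolding sum_distrib_left sum.distrib[symmetric]
    by (intro sum.cong refl) (simp add: power2_eq_square algebra_simps)
  then show ?thesis unfolding sum_kk_Bernstein sum_k_Bernstein sum_Bernstein
    by (simp add: power2_eq_square algebra_simps)
qed

lemma card_nat_interval_le:
  fixes c s :: real
  assumes "s \<ge> 0"
  shows "real (card {t::nat. \<bar>real t - c\<bar> < s}) \<le> 2 * s + 1"
proof -
  let ?W = "{t::nat. \<bar>real t - c\<bar> < s}"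
  have "int ` ?W \<subseteq> {\<lceil>c - s\<rceil>..\<lfloor>c + s\<rfloor>}"
    by (auto simp: ceiling_le_iff le_floor_iff)
  then have "card (int ` ?W) \<le> card {\<lceil>c - s\<rceil>..\<lfloor>c + s\<rfloor>}"
    by (intro card_mono) auto
  then have "card ?W \<le> card {\<lceil>c - s\<rceil>..\<lfloor>c + s\<rfloor>}"
    by (simp add: card_image)
  then have "real (card ?W) \<le> real (nat (\<lfloor>c + s\<rfloor> - \<lceil>c - s\<rceil> + 1))"
    by (simp add: algebra_simps)
  also have "\<dots> \<le> 2 * s + 1" using assms by linarith
  finally show ?thesis .
qed

text \<open>By Chebyshev, a window of width \<open>4 * s\<close> around the mean carries mass at least \<open>3 / 4\<close>.\<close>

lemma Bernstein_mode_ge: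
  fixes r s :: real
  assumes r: "0 < r" "r < 1" and s: "s > 0" "real m * r * (1 - r) \<le> s\<^sup>2"
  obtains t where "t \<le> m" "\<bar>real t - real m * r\<bar> \<le> 1"
    "3 / 4 \<le> (4 * s + 1) * Bernstein m t r"
proof -
  obtain t0 where t0: "t0 \<le> m" "\<bar>real t0 - real m * r\<bar> \<le> 1"
    and mode: "\<And>t. t \<le> m \<Longrightarrow> Bernstein m t r \<le> Bernstein m t0 r"
    using Bernstein_le_mode[OF r] by blast
  let ?b = "\<lambda>t. Bernstein m t r"
  let ?W = "{t. \<bar>real t - real m * r\<bar> < 2 * s}"
  have nn: "?b t \<ge> 0" for t using r by (intro Bernstein_nonneg) auto
  have "1 = (\<Sum>t\<le>m. ?b t)" by simp
  \<comment> \<open>Inside the window a weight is at most that of the mode; outside it the quotient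
    of squares is at least 1. The second part sums to at most \<open>1 / 4\<close>.\<close>
  also have "\<dots> \<le> (\<Sum>t\<le>m. (if t \<in> ?W then ?b t0 else 0) + (real t - real m * r)\<^sup>2 * ?b t / (4 * s\<^sup>2))"
  proof (rule sum_mono)
    fix t assume "t \<in> {..m}"
    then have tm: "t \<le> m" by simp
    show "?b t \<le> (if t \<in> ?W then ?b t0 else 0) + (real t - real m * r)\<^sup>2 * ?b t / (4 * s\<^sup>2)"
    proof (cases "t \<in> ?W")
      case True
      then show ?thesis using mode[OF tm] nn[of t] by (simp add: add_increasing2)
    next
      case False
      then have "(2 * s)\<^sup>2 \<le> \<bar>real t - real m * r\<bar>\<^sup>2"
        using s by (intro power_mono) auto
      then have "4 * s\<^sup>2 * ?b t \<le> (real t - real m * r)\<^sup>2 * ?b t"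
        using nn by (intro mult_right_mono) (auto simp: power_mult_distrib)
      then show ?thesis using False s by (simp add: field_simps)
    qed
  qed
  also have "\<dots> = real (card ({..m} \<inter> ?W)) * ?b t0 + real m * r * (1 - r) / (4 * s\<^sup>2)"
    unfolding sum.distrib sum_divide_distrib[symmetric] Bernstein_variance
    by (simp add: sum.If_cases)
  also have "\<dots> \<le> (4 * s + 1) * ?b t0 + 1 / 4"
  proof (rule add_mono)
    have fin: "finite ?W"
      by (rule finite_subset[of _ "{..nat \<lceil>real m * r + 2 * s\<rceil>}"]) (auto, linarith)
    have "real (card ({..m} \<inter> ?W)) \<le> real (card ?W)"
      using fin by (simp add: card_mono)
    also have "\<dots> \<le> 4 * s + 1" using card_nat_interval_le[of "2 * s" "real m * r"] s by simp
    finally show "real (card ({..m} \<inter> ?W)) * ?b t0 \<le> (4 * s + 1) * ?b t0"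
      using nn by (intro mult_right_mono)
    show "real m * r * (1 - r) / (4 * s\<^sup>2) \<le> 1 / 4" using s by (simp add: field_simps)
  qed
  finally have "3 / 4 \<le> (4 * s + 1) * ?b t0" by simp
  then show ?thesis using that t0 by blast
qed

section \<open>Exponential tilting and the overlap of two binomial distributions\<close>

text \<open>The normalising constant of the tilted Bernoulli distribution; minus its logarithm is
  what the Chernoff information maximises over \<alpha>.\<close>

definition bernoulli_affinity :: "real \<Rightarrow> real \<Rightarrow> real \<Rightarrow> real" where
  "bernoulli_affinity \<alpha> p q =
     p powr (1 - \<alpha>) * q powr \<alpha> + (1 - p) powr (1 - \<alpha>) * (1 - q) powr \<alpha>"

text \<open>Apply \<open>ln x \<le> x - 1\<close> to both terms, strictly in the first; the linear
  bounds cancel. Used in both directions to place the balanced parameter strictly between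
  \<open>q\<close> and \<open>p\<close>.\<close>

lemma bernoulli_relative_entropy_pos:
  fixes p q :: real
  assumes "0 < p" "p < 1" "0 < q" "q < 1" "p \<noteq> q"
  shows "p * ln (p / q) + (1 - p) * ln ((1 - p) / (1 - q)) > 0"
proof -
  have "ln (q / p) < q / p - 1"
    using assms ln_le_minus_one[of "q / p"] ln_eq_minus_one[of "q / p"] by fastforce
  then have 1: "p * ln (q / p) < q - p" using assms
    by (simp add: field_simps)
  have "ln ((1 - q) / (1 - p)) \<le> (1 - q) / (1 - p) - 1"
    using assms by (intro ln_le_minus_one) auto
  then have 2: "(1 - p) * ln ((1 - q) / (1 - p)) \<le> p - q" using assms
    by (simp add: field_simps)
  from 1 2 show ?thesis using assms by (simp add: ln_div algebra_simps)
qed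

text \<open>\<open>r\<close> is the parameter at which the likelihood ratio is balanced, and \<open>\<alpha>\<close> is the exponent
  whose tilted Bernoulli distribution has parameter \<open>r\<close>.\<close>

lemma bernoulli_tilting:
  fixes p q :: real
  assumes pq: "0 < q" "q < p" "p < 1"
  obtains \<alpha> r where "0 < \<alpha>" "\<alpha> < 1" "0 < r" "r < p"
    "p powr (1 - \<alpha>) * q powr \<alpha> = r * bernoulli_affinity \<alpha> p q"
    "(1 - p) powr (1 - \<alpha>) * (1 - q) powr \<alpha> = (1 - r) * bernoulli_affinity \<alpha> p q"
    "r * ln (p / q) = (1 - r) * ln ((1 - q) / (1 - p))"
proof -
  define A where "A = ln (p / q)"
  define B where "B = ln ((1 - q) / (1 - p))"
  have A: "A > 0" and B: "B > 0" using pq by (auto simp: A_def B_def)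
  \<comment> \<open>The solution of \<open>r * A = (1 - r) * B\<close>, at which the log-likelihood
    ratio has mean zero.\<close>
  define r where "r = B / (A + B)"
  have r1: "r * A = (1 - r) * B" using A B by (simp add: r_def field_simps)
  have r01: "0 < r" "r < 1" using A B by (auto simp: r_def)
  have "p * A - (1 - p) * B > 0"
    using bernoulli_relative_entropy_pos[of p q] pq by (simp add: A_def B_def ln_div algebra_simps)
  then have rp: "r < p" using A B by (simp add: r_def field_simps)
  have "q * A - (1 - q) * B < 0"
    using bernoulli_relative_entropy_pos[of q p] pq by (simp add: A_def B_def ln_div algebra_simps)
  then have qr: "q < r" using A B by (simp add: r_def field_simps)
  \<comment> \<open>Tilting interpolates log-odds linearly, so \<alpha> is found by solving
    \<open>(1 - \<alpha>) * L p + \<alpha> * L q = L r\<close>.\<close>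
  define L where "L = (\<lambda>x::real. ln x - ln (1 - x))"
  have Lmono: "L x < L y" if "0 < x" "x < y" "y < 1" for x y
    using that by (auto simp: L_def intro!: diff_strict_mono)
  have L: "L q < L r" "L r < L p" using Lmono[of q r] Lmono[of r p] qr rp pq r01 by auto
  define \<alpha> where "\<alpha> = (L p - L r) / (L p - L q)"
  have \<alpha>: "0 < \<alpha>" "\<alpha> < 1" using L by (auto simp: \<alpha>_def)
  have "\<alpha> * (L p - L q) = L p - L r" using L by (simp add: \<alpha>_def)
  then have Lr: "(1 - \<alpha>) * L p + \<alpha> * L q = L r" by (simp add: algebra_simps)
  define X where "X = p powr (1 - \<alpha>) * q powr \<alpha>"
  define Y where "Y = (1 - p) powr (1 - \<alpha>) * (1 - q) powr \<alpha>"
  have XY: "X > 0" "Y > 0" using pq by (auto simp: X_def Y_def)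
  have "ln X - ln Y = L r"
    using pq Lr by (simp add: X_def Y_def ln_mult ln_powr L_def algebra_simps)
  then have "ln (X * (1 - r)) = ln (Y * r)" using XY r01 by (simp add: ln_mult L_def)
  then have "X * (1 - r) = Y * r" using XY r01 by (subst (asm) ln_inj_iff) auto
  moreover have "bernoulli_affinity \<alpha> p q = X + Y" by (simp add: bernoulli_affinity_def X_def Y_def)
  ultimately have "X = r * bernoulli_affinity \<alpha> p q" "Y = (1 - r) * bernoulli_affinity \<alpha> p q"
    by (simp_all add: algebra_simps)
  then show ?thesis
    using that[of \<alpha> r] \<alpha> r01 rp r1 by (simp add: X_def Y_def A_def B_def)
qed

text \<open>On the logarithmic scale a weighted geometric mean is a convex combination, so it
  exceeds neither argument by more than their gap.\<close>

lemma min_ge_geometric_mean: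
  fixes a b \<alpha> l :: real
  assumes "0 < a" "0 < b" "0 \<le> \<alpha>" "\<alpha> \<le> 1" "\<bar>ln a - ln b\<bar> \<le> l"
  shows "a powr (1 - \<alpha>) * b powr \<alpha> * exp (- l) \<le> min a b"
proof -
  have e: "a powr (1 - \<alpha>) * b powr \<alpha> * exp (- l) = exp ((1 - \<alpha>) * ln a + \<alpha> * ln b - l)"
    using assms by (simp add: powr_def flip: exp_add)
  have "\<alpha> * (ln b - ln a) \<le> 1 * l" "(1 - \<alpha>) * (ln a - ln b) \<le> 1 * l"
    using assms by (auto intro!: mult_mono' order_trans[OF mult_left_mono[of _ l]] mult_left_le_one_le)
  then have "(1 - \<alpha>) * ln a + \<alpha> * ln b - l \<le> ln a" "(1 - \<alpha>) * ln a + \<alpha> * ln b - l \<le> ln b"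
    by (auto simp: algebra_simps)
  then show ?thesis unfolding e using assms by (auto simp: ln_ge_iff)
qed

text \<open>Here \<open>t\<close> is the mode of the binomial distribution with the balanced
  parameter \<open>r\<close>. The first factor is the bound on its weight, the second, the inverse
  odds ratio, is the price of replacing a geometric mean by the minimum, and the affinity power is
  the normalising constant of the tilt.\<close>

lemma binomial_overlap:
  fixes p q s :: real
  assumes pq: "0 < q" "q < p" "p < 1" and s: "s > 0" "real m * p \<le> s\<^sup>2"
  obtains \<alpha> t where "0 < \<alpha>" "\<alpha> < 1" "t \<le> m"
    "real (m choose t) * min (p ^ t * (1 - p) ^ (m - t)) (q ^ t * (1 - q) ^ (m - t))
      \<ge> 3 / (4 * (4 * s + 1)) * (q * (1 - p) / (p * (1 - q))) * bernoulli_affinity \<alpha> p q ^ m"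
proof -
  obtain \<alpha> r where \<alpha>: "0 < \<alpha>" "\<alpha> < 1" and r: "0 < r" "r < p"
    and X: "p powr (1 - \<alpha>) * q powr \<alpha> = r * bernoulli_affinity \<alpha> p q"
    and Y: "(1 - p) powr (1 - \<alpha>) * (1 - q) powr \<alpha> = (1 - r) * bernoulli_affinity \<alpha> p q"
    and bal: "r * ln (p / q) = (1 - r) * ln ((1 - q) / (1 - p))"
    using bernoulli_tilting[OF pq] by blast
  have "real m * r * (1 - r) \<le> real m * p * 1" using r pq by (intro mult_mono) auto
  then have "real m * r * (1 - r) \<le> s\<^sup>2" using s by simp
  then obtain t where t: "t \<le> m" "\<bar>real t - real m * r\<bar> \<le> 1"
    and B: "3 / 4 \<le> (4 * s + 1) * Bernstein m t r"
    using Bernstein_mode_ge[of r s m] r pq s by auto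
  define Z where "Z = bernoulli_affinity \<alpha> p q"
  have Z: "Z > 0" using pq by (auto simp: Z_def bernoulli_affinity_def intro: add_pos_pos)
  define a where "a = p ^ t * (1 - p) ^ (m - t)"
  define b where "b = q ^ t * (1 - q) ^ (m - t)"
  define l where "l = ln (p * (1 - q) / (q * (1 - p)))"
  have l: "l = ln (p / q) + ln ((1 - q) / (1 - p))"
    using pq by (simp add: l_def ln_mult ln_div)
  moreover have "ln (p / q) > 0" "ln ((1 - q) / (1 - p)) > 0" using pq by auto
  ultimately have l_pos: "l > 0" by linarith
  have ab: "a > 0" "b > 0" using pq by (auto simp: a_def b_def)
  have "ln a - ln b = real t * ln (p / q) - (real m - real t) * ln ((1 - q) / (1 - p))"
    using pq t by (simp add: a_def b_def ln_mult ln_div ln_realpow of_nat_diff algebra_simps)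
  \<comment> \<open>The balance equation centres the log-likelihood ratio at \<open>m * r\<close>;
    one more success changes it by the log odds ratio \<open>l\<close>, and \<open>t\<close> is
    within 1 of the centre.\<close>
  also have "\<dots> = (real t - real m * r) * l"
  proof -
    have "real m * (r * ln (p / q)) = real m * ((1 - r) * ln ((1 - q) / (1 - p)))"
      using bal by simp
    then show ?thesis unfolding l by (simp add: algebra_simps)
  qed
  finally have "\<bar>ln a - ln b\<bar> \<le> l" using t l_pos by (simp add: abs_mult)
  then have m1: "a powr (1 - \<alpha>) * b powr \<alpha> * exp (- l) \<le> min a b"
    using ab \<alpha> by (intro min_ge_geometric_mean) auto
  have pw: "(x ^ k * y ^ j) powr c = (x powr c) ^ k * (y powr c) ^ j"
    if "x > 0" "y > 0" for x y c :: real and k j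
    using that by (simp add: powr_mult powr_powr mult.commute flip: powr_realpow)
  have "a powr (1 - \<alpha>) * b powr \<alpha> =
      (p powr (1 - \<alpha>) * q powr \<alpha>) ^ t * ((1 - p) powr (1 - \<alpha>) * (1 - q) powr \<alpha>) ^ (m - t)"
    unfolding a_def b_def using pq by (simp add: pw power_mult_distrib)
  also have "\<dots> = r ^ t * (1 - r) ^ (m - t) * (Z ^ t * Z ^ (m - t))"
    unfolding X Y Z_def[symmetric] by (simp add: power_mult_distrib)
  also have "Z ^ t * Z ^ (m - t) = Z ^ m" using t by (simp flip: power_add)
  finally have m2: "a powr (1 - \<alpha>) * b powr \<alpha> = r ^ t * (1 - r) ^ (m - t) * Z ^ m" .
  have el: "exp (- l) = q * (1 - p) / (p * (1 - q))"
    unfolding l_def exp_minus using pq by simp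
  have "3 / (4 * (4 * s + 1)) * (exp (- l) * Z ^ m) \<le> Bernstein m t r * (exp (- l) * Z ^ m)"
    using B s Z by (intro mult_right_mono) (auto simp: field_simps)
  also have "\<dots> = real (m choose t) * (a powr (1 - \<alpha>) * b powr \<alpha> * exp (- l))"
    unfolding m2 Bernstein_def by simp
  also have "\<dots> \<le> real (m choose t) * min a b" using m1 by (intro mult_left_mono) auto
  finally show ?thesis using that[of \<alpha> t] \<alpha> t unfolding el a_def b_def Z_def by (simp add: mult.assoc)
qed

section \<open>Chernoff information of binomial and product Bernoulli distributions\<close>

lemma bernoulli_affinity_pos:
  assumes "0 < p" "p < 1" "0 < q" "q < 1"
  shows "bernoulli_affinity \<alpha> p q > 0"
  using assms by (auto simp: bernoulli_affinity_def intro: add_pos_pos)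

text \<open>Young's inequality bounds both terms by weighted arithmetic means, which add up to
  1.\<close>

lemma bernoulli_affinity_le_1:
  assumes "0 < p" "p < 1" "0 < q" "q < 1" "0 < \<alpha>" "\<alpha> < 1"
  shows "bernoulli_affinity \<alpha> p q \<le> 1"
proof -
  have "p powr (1 - \<alpha>) * q powr \<alpha> \<le> (1 - \<alpha>) * p + \<alpha> * q"
    using assms by (intro Youngs_inequality_0) auto
  moreover have "(1 - p) powr (1 - \<alpha>) * (1 - q) powr \<alpha> \<le> (1 - \<alpha>) * (1 - p) + \<alpha> * (1 - q)"
    using assms by (intro Youngs_inequality_0) auto
  ultimately show ?thesis by (simp add: bernoulli_affinity_def algebra_simps)
qed

text \<open>The two powers of the binomial coefficient recombine to the coefficient itself, and the
  binomial theorem sums the series.\<close>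

lemma infsum_binomial_affinity:
  assumes "0 < p" "p < 1" "0 < q" "q < 1"
  shows "(\<Sum>\<^sub>\<infinity>x. pmf (binomial_pmf m p) x powr (1 - \<alpha>) * pmf (binomial_pmf m q) x powr \<alpha>)
           = bernoulli_affinity \<alpha> p q ^ m"
proof -
  let ?X = "p powr (1 - \<alpha>) * q powr \<alpha>" and ?Y = "(1 - p) powr (1 - \<alpha>) * (1 - q) powr \<alpha>"
  have "(\<Sum>\<^sub>\<infinity>x. pmf (binomial_pmf m p) x powr (1 - \<alpha>) * pmf (binomial_pmf m q) x powr \<alpha>)
      = (\<Sum>\<^sub>\<infinity>x\<in>{..m}. real (m choose x) * ?X ^ x * ?Y ^ (m - x))"
  proof (rule infsum_cong_neutral)
    fix x assume "x \<in> UNIV \<inter> {..m}"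
    let ?c = "real (m choose x)"
    have pw: "(c * u ^ k * v ^ j) powr d = c powr d * (u powr d) ^ k * (v powr d) ^ j"
      if "c \<ge> 0" "u > 0" "v > 0" for c u v d :: real and k j
      using that by (simp add: powr_mult powr_powr mult.commute flip: powr_realpow)
    have c: "?c powr (1 - \<alpha>) * ?c powr \<alpha> = ?c" by (simp flip: powr_add)
    have "pmf (binomial_pmf m p) x powr (1 - \<alpha>) * pmf (binomial_pmf m q) x powr \<alpha>
        = (?c powr (1 - \<alpha>) * ?c powr \<alpha>) * ?X ^ x * ?Y ^ (m - x)"
      using assms by (simp add: pw power_mult_distrib)
    then show "pmf (binomial_pmf m p) x powr (1 - \<alpha>) * pmf (binomial_pmf m q) x powr \<alpha>
        = ?c * ?X ^ x * ?Y ^ (m - x)"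
      unfolding c .
  qed (use assms in auto)
  also have "\<dots> = (?X + ?Y) ^ m" by (simp add: binomial_ring atLeast0AtMost)
  finally show ?thesis by (simp add: bernoulli_affinity_def)
qed

text \<open>\<open>prod_sum_PiE\<close> transferred to functions with default value \<open>d\<close>
  off \<open>A\<close>, the shape that the support of \<open>Pi_pmf\<close> has.\<close>

lemma sum_prod_PiE_dflt:
  fixes g :: "'a \<Rightarrow> 'b \<Rightarrow> 'c :: comm_semiring_1"
  assumes "finite A" "\<And>x. x \<in> A \<Longrightarrow> finite (B x)"
  shows "(\<Sum>f\<in>PiE_dflt A d B. \<Prod>x\<in>A. g x (f x)) = (\<Prod>x\<in>A. \<Sum>y\<in>B x. g x y)"
proof -
  have inj: "inj_on (\<lambda>h x. if x \<in> A then h x else d) (PiE A B)"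
    by (intro inj_onI ext) (metis PiE_arb)
  have "(\<Sum>f\<in>PiE_dflt A d B. \<Prod>x\<in>A. g x (f x)) = (\<Sum>f\<in>PiE A B. \<Prod>x\<in>A. g x (f x))"
    unfolding dflt_image_PiE[symmetric] by (simp add: sum.reindex[OF inj])
  then show ?thesis using prod_sum_PiE[of A B g] assms by simp
qed

text \<open>Both mass functions vanish off the finite set of functions that are \<open>False\<close>
  outside \<open>{1..n}\<close>; on it the summand factorises over coordinates.\<close>

lemma infsum_bernoulli_product_affinity:
  assumes "\<forall>j\<in>{1..n}. 0 < a j \<and> a j < 1 \<and> 0 < b j \<and> b j < 1"
  shows "(\<Sum>\<^sub>\<infinity>x. pmf (bernoulli_product n a) x powr (1 - \<alpha>) * pmf (bernoulli_product n b) x powr \<alpha>)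
           = (\<Prod>j\<in>{1..n}. bernoulli_affinity \<alpha> (a j) (b j))"
proof -
  let ?S = "PiE_dflt {1..n} False (\<lambda>_. UNIV :: bool set)"
  have fin: "finite ?S" by (intro finite_PiE_dflt) auto
  let ?g = "\<lambda>j y. pmf (bernoulli_pmf (a j)) y powr (1 - \<alpha>) * pmf (bernoulli_pmf (b j)) y powr \<alpha>"
  have "(\<Sum>\<^sub>\<infinity>x. pmf (bernoulli_product n a) x powr (1 - \<alpha>) * pmf (bernoulli_product n b) x powr \<alpha>)
      = (\<Sum>\<^sub>\<infinity>x\<in>?S. \<Prod>j\<in>{1..n}. ?g j (x j))"
  proof (rule infsum_cong_neutral)
    fix x assume "x \<in> UNIV \<inter> ?S"
    then have x: "\<forall>j. j \<notin> {1..n} \<longrightarrow> x j = False" by (auto simp: PiE_dflt_def)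
    show "pmf (bernoulli_product n a) x powr (1 - \<alpha>) * pmf (bernoulli_product n b) x powr \<alpha>
        = (\<Prod>j\<in>{1..n}. ?g j (x j))"
      unfolding bernoulli_product_def using x
      by (simp add: pmf_Pi prod_powr_distrib prod.distrib)
  next
    fix x assume "x \<in> UNIV - ?S"
    then have "\<not> (\<forall>j. j \<notin> {1..n} \<longrightarrow> x j = False)" by (auto simp: PiE_dflt_def)
    then show "pmf (bernoulli_product n a) x powr (1 - \<alpha>) * pmf (bernoulli_product n b) x powr \<alpha> = 0"
      unfolding bernoulli_product_def by (subst pmf_Pi) auto
  qed auto
  also have "\<dots> = (\<Prod>j\<in>{1..n}. \<Sum>y\<in>UNIV. ?g j y)"
    unfolding infsum_finite[OF fin] by (intro sum_prod_PiE_dflt) auto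
  also have "\<dots> = (\<Prod>j\<in>{1..n}. bernoulli_affinity \<alpha> (a j) (b j))"
  proof (rule prod.cong[OF refl])
    fix j assume "j \<in> {1..n}"
    then have "0 < a j" "a j < 1" "0 < b j" "b j < 1" using assms by blast+
    then show "(\<Sum>y\<in>UNIV. ?g j y) = bernoulli_affinity \<alpha> (a j) (b j)"
      by (simp add: UNIV_bool bernoulli_affinity_def)
  qed
  finally show ?thesis .
qed

text \<open>Parameters inside the unit interval make every affinity positive, so the infinite case
  of \<open>chernoff\<close> does not arise.\<close>

lemma chernoff_binomial:
  assumes "0 < p" "p < 1" "0 < q" "q < 1"
  shows "chernoff (binomial_pmf m p) (binomial_pmf m q)
           = (SUP \<alpha>\<in>{0<..<1}. ereal (- ln (bernoulli_affinity \<alpha> p q ^ m)))"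
proof -
  have "bernoulli_affinity \<alpha> p q ^ m \<noteq> 0" for \<alpha>
    using bernoulli_affinity_pos[OF assms] by (metis less_irrefl zero_less_power)
  then show ?thesis
    unfolding chernoff_def infsum_binomial_affinity[OF assms] Let_def by (simp only: if_False)
qed

lemma chernoff_vec_eq:
  assumes "\<forall>j\<in>{1..n}. 0 < a j \<and> a j < 1 \<and> 0 < b j \<and> b j < 1"
  shows "chernoff_vec n a b
           = (SUP \<alpha>\<in>{0<..<1}. ereal (- ln (\<Prod>j\<in>{1..n}. bernoulli_affinity \<alpha> (a j) (b j))))"
proof -
  have "(\<Prod>j\<in>{1..n}. bernoulli_affinity \<alpha> (a j) (b j)) \<noteq> 0" for \<alpha>
    using bernoulli_affinity_pos assms
    by (intro less_imp_neq[symmetric] prod_pos) auto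
  then show ?thesis
    unfolding chernoff_vec_def chernoff_def infsum_bernoulli_product_affinity[OF assms] Let_def
    by (simp only: if_False)
qed

text \<open>Substituting \<open>1 - \<alpha>\<close> for \<alpha> exchanges the arguments.\<close>

lemma chernoff_commute: "chernoff \<phi> \<psi> = chernoff \<psi> \<phi>"
proof -
  have "chernoff \<phi> \<psi> \<le> chernoff \<psi> \<phi>" for \<phi> \<psi> :: "'a pmf"
    unfolding chernoff_def
  proof (rule SUP_mono, goal_cases)
    case (1 \<alpha>)
    then show ?case by (intro bexI[of _ "1 - \<alpha>"]) (auto simp: mult.commute)
  qed
  then show ?thesis by (intro antisym)
qed

text \<open>For each \<alpha> every coordinate affinity is at most 1, so discarding the coordinates
  outside \<open>J\<close> and the surplus ones in \<open>J\<close> only enlarges the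
  product.\<close>

lemma chernoff_vec_ge_binomial:
  assumes pq: "0 < p" "p < 1" "0 < q" "q < 1"
    and ab: "\<forall>j\<in>{1..n}. 0 < a j \<and> a j < 1 \<and> 0 < b j \<and> b j < 1"
    and J: "J \<subseteq> {1..n}" "m \<le> card J" "\<And>j. j \<in> J \<Longrightarrow> a j = p \<and> b j = q"
  shows "chernoff (binomial_pmf m p) (binomial_pmf m q) \<le> chernoff_vec n a b"
  unfolding chernoff_binomial[OF pq] chernoff_vec_eq[OF ab]
proof (rule SUP_mono)
  fix \<alpha> :: real assume \<alpha>: "\<alpha> \<in> {0<..<1}"
  let ?Z = "bernoulli_affinity \<alpha> p q" and ?R = "\<lambda>j. bernoulli_affinity \<alpha> (a j) (b j)"
  have R: "0 < ?R j" "?R j \<le> 1" if "j \<in> {1..n}" for j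
    using ab that \<alpha> by (auto intro: bernoulli_affinity_pos bernoulli_affinity_le_1)
  have Z: "0 < ?Z" "?Z \<le> 1" using pq \<alpha> by (auto intro: bernoulli_affinity_pos bernoulli_affinity_le_1)
  have "prod ?R {1..n} = prod ?R J * prod ?R ({1..n} - J)"
    using J(1) by (simp add: prod.subset_diff mult.commute)
  also have "\<dots> \<le> prod ?R J * 1"
    using R J(1) by (intro mult_left_mono prod_le_1 prod_nonneg) (auto simp: less_imp_le subset_iff)
  also have "prod ?R J = ?Z ^ card J" using J(3) by simp
  also have "?Z ^ card J * 1 \<le> ?Z ^ m" using Z J(2) by (simp add: power_decreasing)
  finally have "prod ?R {1..n} \<le> ?Z ^ m" .
  moreover have "prod ?R {1..n} > 0" using R by (intro prod_pos) auto
  ultimately have "ereal (- ln (?Z ^ m)) \<le> ereal (- ln (prod ?R {1..n}))" by (simp add: ln_mono)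
  then show "\<exists>\<alpha>'\<in>{0<..<1}. ereal (- ln (?Z ^ m)) \<le>
      ereal (- ln (\<Prod>j\<in>{1..n}. bernoulli_affinity \<alpha>' (a j) (b j)))"
    using \<alpha> by blast
qed

text \<open>\<open>D\<close> is a supremum, so it dominates the value at any single exponent, in
  particular at the tilting one.\<close>

lemma exp_minus_chernoff_binomial_le:
  assumes pq: "0 < p" "p < 1" "0 < q" "q < 1" and \<alpha>: "0 < \<alpha>" "\<alpha> < 1"
    and D: "ereal D = chernoff (binomial_pmf m p) (binomial_pmf m q)"
  shows "exp (- D) \<le> bernoulli_affinity \<alpha> p q ^ m"
proof -
  have Z: "bernoulli_affinity \<alpha> p q ^ m > 0" using bernoulli_affinity_pos[OF pq] by simp
  have "ereal (- ln (bernoulli_affinity \<alpha> p q ^ m)) \<le> ereal D"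
    unfolding D chernoff_binomial[OF pq] using \<alpha> by (intro SUP_upper) auto
  then have "- D \<le> ln (bernoulli_affinity \<alpha> p q ^ m)" by simp
  then show ?thesis using Z by (simp add: ln_ge_iff)
qed

section \<open>Testing two product Bernoulli measures\<close>

text \<open>Two product Bernoulli measures that differ only on the coordinates in \<open>B\<close>, with parameters
  \<open>p\<close> and \<open>q\<close> there: restricting to the event that exactly \<open>t\<close> of these coordinates are set makes
  the likelihood ratio constant.\<close>

lemma bernoulli_testing_lower_bound:
  fixes f1 f2 :: "'e \<Rightarrow> real"
  assumes E: "finite E" "B \<subseteq> E"
    and f: "\<And>e. e \<in> E - B \<Longrightarrow> f1 e = f2 e" "\<And>e. e \<in> B \<Longrightarrow> f1 e = p" "\<And>e. e \<in> B \<Longrightarrow> f2 e = q"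
    and pq: "0 < p" "p < 1" "0 < q" "q < 1"
  defines "\<mu>1 \<equiv> Pi_pmf E False (\<lambda>e. bernoulli_pmf (f1 e))"
    and "\<mu>2 \<equiv> Pi_pmf E False (\<lambda>e. bernoulli_pmf (f2 e))"
  shows "real (card B choose t) *
      min (p ^ t * (1 - p) ^ (card B - t)) (q ^ t * (1 - q) ^ (card B - t))
    \<le> measure_pmf.prob \<mu>1 G + measure_pmf.prob \<mu>2 (- G)"
proof -
  define S where "S = PiE_dflt E False (\<lambda>_. UNIV :: bool set)"
  have finS: "finite S" unfolding S_def using E by (intro finite_PiE_dflt) auto
  have finB: "finite B" using E finite_subset by blast
  define a where "a = p ^ t * (1 - p) ^ (card B - t)"
  define b where "b = q ^ t * (1 - q) ^ (card B - t)"
  have ab: "a > 0" "b > 0" using pq by (auto simp: a_def b_def)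
  \<comment> \<open>The contribution of the coordinates outside \<open>B\<close>, common to both
    measures; on \<open>T\<close> the likelihood ratio is therefore \<open>a / b\<close>.\<close>
  define w where "w = (\<lambda>X. \<Prod>e\<in>E - B. pmf (bernoulli_pmf (f1 e)) (X e))"
  have w: "w X \<ge> 0" for X by (auto simp: w_def intro: prod_nonneg)
  define T where "T = {X \<in> S. card {e\<in>B. X e} = t}"
  have finT: "finite T" using finS by (simp add: T_def)
  have prodB: "(\<Prod>e\<in>B. pmf (bernoulli_pmf (g e)) (X e)) = c ^ t * (1 - c) ^ (card B - t)"
    if "card {e\<in>B. X e} = t" "\<And>e. e \<in> B \<Longrightarrow> g e = c" "0 < c" "c < 1" for g X c
  proof -
    have "(\<Prod>e\<in>B. pmf (bernoulli_pmf (g e)) (X e)) = (\<Prod>e\<in>B. if X e then c else 1 - c)"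
      using that by (intro prod.cong) auto
    also have "\<dots> = c ^ card {e\<in>B. X e} * (1 - c) ^ card {e\<in>B. \<not> X e}"
      using finB by (simp add: prod.If_cases Int_def)
    also have "card {e\<in>B. \<not> X e} = card (B - {e\<in>B. X e})" by (rule arg_cong[of _ _ card]) auto
    also have "\<dots> = card B - t" using finB that(1) by (subst card_Diff_subset) auto
    finally show ?thesis using that(1) by simp
  qed
  have split: "prod g E = prod g B * prod g (E - B)" for g :: "'e \<Rightarrow> real"
    using E by (simp add: prod.subset_diff mult.commute)
  have pmf1: "pmf \<mu>1 X = a * w X" if "X \<in> T" for X
    using that E pq f(2) prodB[of X f1 p] unfolding \<mu>1_def T_def S_def a_def w_def
    by (subst pmf_Pi') (auto simp: PiE_dflt_def split)
  have w2: "w X = (\<Prod>e\<in>E - B. pmf (bernoulli_pmf (f2 e)) (X e))" for X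
    unfolding w_def using f(1) by (intro prod.cong) auto
  have pmf2: "pmf \<mu>2 X = b * w X" if "X \<in> T" for X
    using that E pq f(3) prodB[of X f2 q] unfolding \<mu>2_def T_def S_def b_def w2
    by (subst pmf_Pi') (auto simp: PiE_dflt_def split)
  \<comment> \<open>The probability of \<open>T\<close> is a binomial weight, because the
    coordinates in \<open>B\<close> are independent with common parameter \<open>p\<close>.
    Cancelling \<open>a\<close> in it then evaluates \<open>sum w T\<close>.\<close>
  have "measure_pmf.prob \<mu>1 T = measure_pmf.prob \<mu>1 {X. card {e\<in>B. X e} = t}"
    by (intro measure_prob_cong_0)
       (use E in \<open>auto simp: T_def S_def \<mu>1_def pmf_Pi PiE_dflt_def\<close>)
  also have "\<dots> = pmf (map_pmf (\<lambda>X. card {e\<in>B. X e}) \<mu>1) t"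
    by (simp add: pmf_map vimage_def)
  also have "map_pmf (\<lambda>X. card {e\<in>B. X e}) \<mu>1 = map_pmf (\<lambda>X. card {e\<in>B. X e}) (Pi_pmf B False (\<lambda>_. bernoulli_pmf p))"
  proof -
    have "Pi_pmf B False (\<lambda>_. bernoulli_pmf p) = Pi_pmf B False (\<lambda>e. bernoulli_pmf (f1 e))"
      using f(2) by (intro Pi_pmf_cong) auto
    also have "\<dots> = map_pmf (\<lambda>X e. if e \<in> B then X e else False) \<mu>1"
      unfolding \<mu>1_def by (rule Pi_pmf_subset[OF E])
    finally show ?thesis
      by (auto simp: map_pmf_comp intro!: map_pmf_cong arg_cong[of _ _ card])
  qed
  also have "\<dots> = binomial_pmf (card B) p"
    using finB pq by (intro binomial_pmf_altdef'[symmetric]) auto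
  also have "pmf \<dots> t = real (card B choose t) * a" using pq by (simp add: a_def)
  finally have "a * sum w T = real (card B choose t) * a"
    using finT by (simp add: measure_measure_pmf_finite pmf1 sum_distrib_left)
  then have sum_w: "sum w T = real (card B choose t)" using ab by simp
  have "real (card B choose t) * min a b = sum (\<lambda>X. min a b * w X) T"
    unfolding sum_distrib_left[symmetric] sum_w by simp
  also have "\<dots> = sum (\<lambda>X. min a b * w X) (T \<inter> G) + sum (\<lambda>X. min a b * w X) (T - G)"
    using finT by (simp add: sum.Int_Diff)
  also have "\<dots> \<le> sum (pmf \<mu>1) (T \<inter> G) + sum (pmf \<mu>2) (T - G)"
    using w by (intro add_mono sum_mono) (auto simp: pmf1 pmf2 intro!: mult_right_mono)
  also have "\<dots> = measure_pmf.prob \<mu>1 (T \<inter> G) + measure_pmf.prob \<mu>2 (T - G)"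
    using finT by (simp add: measure_measure_pmf_finite)
  also have "\<dots> \<le> measure_pmf.prob \<mu>1 G + measure_pmf.prob \<mu>2 (- G)"
    by (intro add_mono measure_pmf.finite_measure_mono) auto
  finally show ?thesis by (simp add: a_def b_def)
qed

section \<open>From misclassification rate to Hamming loss\<close>

text \<open>Used in contrapositive form: two different relabelings admit a label \<open>k\<close>
  that they never assign together, so on every node of class \<open>k\<close> at least one of them
  errs.\<close>

lemma permutes_eqI_common_preimages:
  assumes "\<pi> permutes A" "\<sigma> permutes A" "\<And>k. k \<in> A \<Longrightarrow> \<exists>x. \<pi> x = k \<and> \<sigma> x = k"
  shows "\<pi> = \<sigma>"
proof
  fix y
  show "\<pi> y = \<sigma> y"
  proof (cases "y \<in> A")
    case True
    then obtain x where "\<pi> x = \<pi> y" "\<sigma> x = \<pi> y"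
      using assms(3)[of "\<pi> y"] permutes_in_image[OF assms(1)] by blast
    then show ?thesis using permutes_inj[OF assms(1)] by (metis injD)
  next
    case False
    then show ?thesis using assms(1,2) by (simp add: permutes_not_in)
  qed
qed

text \<open>The labels outside \<open>S\<close> are known, so a single permutation, chosen without knowledge of the
  labels on \<open>S\<close>, reduces the misclassification rate to a Hamming loss on \<open>S\<close>.\<close>

lemma Mis_ge_hamming:
  assumes n: "n > 0" and S: "S \<subseteq> {1..n}"
    and large: "\<And>k. k \<in> {1..K} \<Longrightarrow> 2 * card S \<le> card {i \<in> {1..n} - S. z0 i = k}"
  obtains g where "\<And>z. (\<And>i. i \<in> {1..n} - S \<Longrightarrow> z i = z0 i) \<Longrightarrow>
    (\<Sum>i\<in>S. of_bool (g (zh i) \<noteq> z i)) \<le> real n * Mis n K zh z"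
proof -
  let ?F = "{1..n} - S" and ?Perm = "{\<pi>. \<pi> permutes {1..K}}"
  \<comment> \<open>The permutation \<open>g\<close> minimises the number of errors on the nodes
    outside \<open>S\<close>, which depends on \<open>zh\<close> and \<open>z0\<close> only; hence
    it serves all \<open>z\<close> at once.\<close>
  define d where "d = (\<lambda>\<pi>. card {i \<in> ?F. \<pi> (zh i) \<noteq> z0 i})"
  have fin: "finite ?Perm" by (simp add: finite_permutations)
  have ne: "?Perm \<noteq> {}" using permutes_id by blast
  obtain g where g: "g permutes {1..K}" and gmin: "\<And>\<pi>. \<pi> permutes {1..K} \<Longrightarrow> d g \<le> d \<pi>"
    using ex_min_if_finite[of "d ` ?Perm"] fin ne by (metis (mono_tags, lifting) arg_min_if_finite(1) arg_min_least mem_Collect_eq)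
  have finS: "finite S" using S finite_subset by blast
  have "(\<Sum>i\<in>S. of_bool (g (zh i) \<noteq> z i)) \<le> real n * Mis n K zh z"
    if z: "\<And>i. i \<in> ?F \<Longrightarrow> z i = z0 i" for z
  proof -
    let ?loss = "\<lambda>\<pi>. 1 / real n * (\<Sum>i=1..n. of_bool (\<pi> (zh i) \<noteq> z i))"
    have "Mis n K zh z \<in> ?loss ` ?Perm"
      unfolding Mis_def using fin ne by (intro Min_in) auto
    then obtain \<pi> where \<pi>: "\<pi> permutes {1..K}" and M: "Mis n K zh z = ?loss \<pi>" by auto
    have nM: "real n * Mis n K zh z = (\<Sum>i=1..n. of_bool (\<pi> (zh i) \<noteq> z i))"
      unfolding M using n by simp
    show ?thesis
    proof (cases "\<pi> = g")
      case True
      show ?thesis unfolding nM True using S by (intro sum_mono2) auto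
    next
      case False
      \<comment> \<open>Every node of class \<open>k\<close> outside \<open>S\<close> is an error of
        \<pi> or of \<open>g\<close>, so
        \<open>2 * card S \<le> d \<pi> + d g \<le> 2 * d \<pi>\<close>. The errors of \<pi> outside
        \<open>S\<close> thus already outnumber \<open>S\<close>, up to equality.\<close>
      then obtain k where k: "k \<in> {1..K}" "\<And>x. \<not> (\<pi> x = k \<and> g x = k)"
        using permutes_eqI_common_preimages[OF \<pi> g] by blast
      have "2 * card S \<le> card {i \<in> ?F. z0 i = k}" by (rule large[OF k(1)])
      also have "\<dots> \<le> card ({i \<in> ?F. \<pi> (zh i) \<noteq> z0 i} \<union> {i \<in> ?F. g (zh i) \<noteq> z0 i})"
        using k(2) by (intro card_mono) auto
      also have "\<dots> \<le> d \<pi> + d g" unfolding d_def by (rule card_Un_le)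
      also have "\<dots> \<le> 2 * d \<pi>" using gmin[OF \<pi>] by simp
      finally have "card S \<le> d \<pi>" by simp
      have "(\<Sum>i\<in>S. of_bool (g (zh i) \<noteq> z i)) \<le> (\<Sum>i\<in>S. 1 :: real)" by (intro sum_mono) auto
      also have "\<dots> \<le> real (d \<pi>)" using \<open>card S \<le> d \<pi>\<close> by simp
      also have "\<dots> = (\<Sum>i\<in>?F. of_bool (\<pi> (zh i) \<noteq> z i))"
        unfolding d_def using z by (simp add: Int_def cong: conj_cong)
      also have "\<dots> \<le> (\<Sum>i=1..n. of_bool (\<pi> (zh i) \<noteq> z i))" by (intro sum_mono2) auto
      finally show ?thesis unfolding nM .
    qed
  qed
  then show ?thesis using that by blast
qed

section \<open>Staircase matrices and balanced labelings\<close>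

text \<open>Rows \<open>k < l\<close> differ in column \<open>K + 1 - k\<close>, and no two rows differ in the first column, so
  class \<open>1\<close> may have fewer than \<open>m\<close> members.\<close>

definition staircase :: "nat \<Rightarrow> real \<Rightarrow> real \<Rightarrow> nat \<Rightarrow> nat \<Rightarrow> real" where
  "staircase K p q k l = (if k + l \<le> K + 1 then p else q)"

lemma staircase_commute: "staircase K p q k l = staircase K p q l k"
  by (simp add: staircase_def add.commute)

lemma staircase_mem_sbm_class:
  assumes K: "K \<ge> 2" and pq: "0 < q" "q < p" "p < 1" and p: "p \<le> 1 - \<epsilon>"
    and \<omega>: "\<omega>' \<le> p / q" "p / q \<le> \<omega>"
    and z: "z \<in> labelings n K"
    and sizes: "\<And>k. k \<in> {1..K} \<Longrightarrow> real n / (\<beta> * real K) \<le> real (card {i\<in>{1..n}. z i = k})"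
      "\<And>k. k \<in> {1..K} \<Longrightarrow> real (card {i\<in>{1..n}. z i = k}) \<le> \<beta> * real n / real K"
    and m: "\<And>k. k \<in> {2..K} \<Longrightarrow> m \<le> card {i\<in>{1..n}. z i = k}"
    and D: "ereal D = chernoff (binomial_pmf m p) (binomial_pmf m q)"
  shows "(z, staircase K p q) \<in> sbm_class \<beta> \<epsilon> \<omega> \<omega>' n p K D"
proof -
  let ?P = "staircase K p q" and ?I = "{1..K} \<times> {1..K}"
  have P01: "?P k l \<in> {0<..<1}" for k l using pq by (auto simp: staircase_def)
  \<comment> \<open>The maximum is attained at \<open>(1, 1)\<close> and the minimum at
    \<open>(K, K)\<close>, where \<open>K + K > K + 1\<close>.\<close>
  have Max_P: "Max ((\<lambda>(k, l). ?P k l) ` ?I) = p"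
    using K pq by (intro Max_eqI) (auto simp: staircase_def image_iff intro!: bexI[of _ "1::nat"])
  have Min_P: "Min ((\<lambda>(k, l). ?P k l) ` ?I) = q"
    using K pq by (intro Min_eqI) (auto simp: staircase_def image_iff intro!: bexI[of _ K])
  have ordered: "\<omega>' \<le> (MAX r\<in>{1..K}. max (?P k r / ?P l r) (?P l r / ?P k r)) \<and>
      ereal D \<le> chernoff_vec n (\<lambda>j. ?P k (z j)) (\<lambda>j. ?P l (z j))"
    if kl: "k \<in> {1..K}" "l \<in> {1..K}" "k < l" for k l
  proof
    \<comment> \<open>The last column in which row \<open>k\<close> still has \<open>p\<close>;
      every later row has \<open>q\<close> there. Since \<open>k < K\<close>, it is not the first
      column, so its class has at least \<open>m\<close> members.\<close>
    define r where "r = K + 1 - k"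
    have r: "r \<in> {2..K}" "r \<in> {1..K}" using kl by (auto simp: r_def)
    have Pr: "?P k r = p" "?P l r = q" using kl by (auto simp: r_def staircase_def)
    have "\<omega>' \<le> max (?P k r / ?P l r) (?P l r / ?P k r)" using \<omega> Pr by simp
    also have "\<dots> \<le> (MAX r\<in>{1..K}. max (?P k r / ?P l r) (?P l r / ?P k r))"
      using r by (intro Max_ge) auto
    finally show "\<omega>' \<le> (MAX r\<in>{1..K}. max (?P k r / ?P l r) (?P l r / ?P k r))" .
    show "ereal D \<le> chernoff_vec n (\<lambda>j. ?P k (z j)) (\<lambda>j. ?P l (z j))"
      unfolding D using m[OF r(1)] Pr pq P01
      by (intro chernoff_vec_ge_binomial[where J = "{i\<in>{1..n}. z i = r}"]) auto
  qed
  have distinct: "\<omega>' \<le> (MAX r\<in>{1..K}. max (?P k r / ?P l r) (?P l r / ?P k r)) \<and>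
      ereal D \<le> chernoff_vec n (\<lambda>j. ?P k (z j)) (\<lambda>j. ?P l (z j))"
    if kl: "k \<in> {1..K}" "l \<in> {1..K}" "k \<noteq> l" for k l
  proof (cases "k < l")
    case False
    then have "l < k" using kl by simp
    then show ?thesis
      using ordered[OF kl(2,1)] by (simp add: chernoff_vec_def chernoff_commute max.commute)
  qed (use ordered kl in blast)
  show ?thesis
    unfolding sbm_class_def mem_Collect_eq prod.case Max_P Min_P
    using P01 staircase_commute[of K p q] z sizes p \<omega> distinct
    by (intro conjI ballI impI) simp_all
qed

text \<open>Consecutive blocks of length \<open>m\<close> receive the labels \<open>2\<close> to
  \<open>K\<close>, and class \<open>1\<close> absorbs all remaining nodes, so that class
  \<open>K\<close> has exactly \<open>m\<close> members. The shift in \<open>(i - 1) div m\<close>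
  is due to nodes being numbered from 1.\<close>

lemma balanced_labeling_exists:
  assumes "K * m \<le> n" "K \<ge> 1"
  obtains z0 where "\<And>i. i \<in> {1..n} \<Longrightarrow> z0 i \<in> {1..K}"
    "\<And>k. k \<in> {2..K} \<Longrightarrow> card {i\<in>{1..n}. z0 i = k} = m"
    "card {i\<in>{1..n}. z0 i = (1::nat)} = n - (K - 1) * m"
proof (cases "m = 0")
  case True
  moreover have "{i. Suc 0 \<le> i \<and> i \<le> n} = {1..n}" by auto
  ultimately show ?thesis using assms by (intro that[of "\<lambda>_. 1"]) auto
next
  case False
  then have m: "m > 0" by simp
  have Km: "(K - 1) * m \<le> n" using assms by (meson diff_le_self le_trans mult_le_mono1)
  define z0 where "z0 = (\<lambda>i. if i \<le> (K - 1) * m then 2 + (i - 1) div m else 1)"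
  have block: "{i\<in>{1..n}. z0 i = k} = {(k - 2) * m + 1..(k - 1) * m}" if k: "k \<in> {2..K}" for k
  proof -
    obtain j where j: "k = j + 2" using k by (metis add.commute atLeastAtMost_iff le_Suc_ex)
    have "(j + 1) * m \<le> (K - 1) * m" using k j by (intro mult_le_mono1) auto
    moreover have idx: "(i - 1) div m = j \<longleftrightarrow> j * m + 1 \<le> i \<and> i \<le> (j + 1) * m" if "i \<ge> 1" for i
    proof -
      obtain i' where i': "i = Suc i'" using \<open>i \<ge> 1\<close> by (cases i) auto
      have "j \<le> i' div m \<longleftrightarrow> j * m \<le> i'" using m by (simp add: less_eq_div_iff_mult_less_eq)
      moreover have "i' div m < j + 1 \<longleftrightarrow> i' < (j + 1) * m" using m by (simp add: div_less_iff_less_mult)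
      ultimately show ?thesis unfolding i' by auto
    qed
    ultimately show ?thesis
    proof (intro set_eqI)
      fix i
      assume le: "(j + 1) * m \<le> (K - 1) * m"
      show "i \<in> {i\<in>{1..n}. z0 i = k} \<longleftrightarrow> i \<in> {(k - 2) * m + 1..(k - 1) * m}"
      proof (cases "i \<ge> 1")
        case True
        have "i \<in> {i\<in>{1..n}. z0 i = k} \<longleftrightarrow> i \<le> n \<and> i \<le> (K - 1) * m \<and> (i - 1) div m = j"
          using True j by (auto simp: z0_def)
        also have "\<dots> \<longleftrightarrow> j * m + 1 \<le> i \<and> i \<le> (j + 1) * m"
          unfolding idx[OF True]
          using le Km order_trans[of i "(j + 1) * m" "(K - 1) * m"] order_trans[of i "(K - 1) * m" n]
          by blast
        finally show ?thesis unfolding j by simp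
      qed auto
    qed
  qed
  have range: "z0 i \<in> {1..K}" if "i \<in> {1..n}" for i
  proof (cases "i \<le> (K - 1) * m")
    case True
    then have "i - 1 < (K - 1) * m" using that by auto
    then have "(i - 1) div m < K - 1" using m by (simp add: div_less_iff_less_mult)
    then show ?thesis using True by (auto simp: z0_def)
  qed (use assms in \<open>auto simp: z0_def\<close>)
  have block_card: "card {i\<in>{1..n}. z0 i = k} = m" if k: "k \<in> {2..K}" for k
  proof -
    have "Suc (k - 2) = k - 1" using k by auto
    then have "(k - 1) * m = (k - 2) * m + m" by (metis add.commute mult_Suc)
    then show ?thesis unfolding block[OF k] card_atLeastAtMost by linarith
  qed
  have one: "{i\<in>{1..n}. z0 i = 1} = {(K - 1) * m + 1..n}" by (auto simp: z0_def)
  have "card {i\<in>{1..n}. z0 i = 1} = n - (K - 1) * m" unfolding one card_atLeastAtMost by linarith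
  with range block_card show ?thesis by (rule that)
qed

section \<open>Two-point bound for one node and averaging over labelings\<close>

text \<open>Rows \<open>1\<close> and \<open>2\<close> of the staircase differ only in column
  \<open>K\<close>, so relabeling node \<open>i\<close> affects only the \<open>m\<close> edge
  variables between \<open>i\<close> and class \<open>K\<close>; their parameter changes from
  \<open>p\<close> to \<open>q\<close>.\<close>

lemma sbm_two_point_lower_bound:
  assumes K: "K \<ge> 3" and pq: "0 < q" "q < p" "p < 1"
    and z: "\<And>j. j \<in> {1..n} \<Longrightarrow> z j \<in> {1..K}" and i: "i \<in> {1..n}" "z i = 1"
    and m: "card {j\<in>{1..n}. z j = K} = m"
  shows "real (m choose t) * min (p ^ t * (1 - p) ^ (m - t)) (q ^ t * (1 - q) ^ (m - t))
    \<le> measure_pmf.prob (sbm n z (staircase K p q)) {A. h A \<noteq> (1::nat)}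
      + measure_pmf.prob (sbm n (z(i := 2)) (staircase K p q)) {A. h A \<noteq> 2}"
proof -
  let ?P = "staircase K p q"
  define E where "E = {(a, b). a \<in> {1..n} \<and> b \<in> {1..n} \<and> a > b}"
  define J where "J = {j\<in>{1..n}. z j = K}"
  \<comment> \<open>Edge variables are indexed with the larger endpoint first, as in
    \<open>sbm\<close>.\<close>
  define B where "B = (\<lambda>j. (max i j, min i j)) ` J"
  define \<phi> :: "(nat \<times> nat \<Rightarrow> bool) \<Rightarrow> nat \<Rightarrow> nat \<Rightarrow> nat" where
    "\<phi> = (\<lambda>X i j. of_bool (if i > j then X (i, j) else X (j, i)))"
  define f :: "(nat \<Rightarrow> nat) \<Rightarrow> nat \<times> nat \<Rightarrow> real" where "f = (\<lambda>z (a, b). ?P (z a) (z b))"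
  have iJ: "i \<notin> J" using i K by (auto simp: J_def)
  have finE: "finite E" by (rule finite_subset[of _ "{1..n} \<times> {1..n}"]) (auto simp: E_def)
  have BE: "B \<subseteq> E"
  proof
    fix e assume "e \<in> B"
    then obtain j where j: "j \<in> J" "e = (max i j, min i j)" by (auto simp: B_def)
    then have "j \<noteq> i" "j \<in> {1..n}" using iJ by (auto simp: J_def)
    then show "e \<in> E" using i(1) j(2) by (auto simp: E_def max_def min_def)
  qed
  have inj: "inj_on (\<lambda>j. (max i j, min i j)) J"
    by (rule inj_onI) (auto simp: max_def min_def split: if_splits)
  have cardB: "card B = m" unfolding B_def card_image[OF inj] unfolding J_def by (rule m)
  have B1: "f z e = p" if "e \<in> B" for e
    using that i K by (auto simp: B_def J_def f_def staircase_def max_def min_def)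
  have B2: "f (z(i := 2)) e = q" if "e \<in> B" for e
    using that i K iJ by (auto simp: B_def J_def f_def staircase_def max_def min_def)
  \<comment> \<open>If such an edge contains \<open>i\<close>, its other endpoint has a label at
    most \<open>K - 1\<close>, so the parameter is \<open>p\<close> before and after.\<close>
  have EB: "f z e = f (z(i := 2)) e" if e: "e \<in> E - B" for e
  proof -
    obtain a b where ab: "e = (a, b)" "a \<in> {1..n}" "b \<in> {1..n}" "b < a"
      using e by (auto simp: E_def)
    have "z b \<noteq> K" if "a = i"
    proof
      assume "z b = K"
      then have "(max i b, min i b) \<in> B" using ab by (auto simp: B_def J_def)
      then show False using e ab that by (simp add: max_def min_def split: if_splits)
    qed
    moreover have "z a \<noteq> K" if "b = i"
    proof
      assume "z a = K"
      then have "(max i a, min i a) \<in> B" using ab by (auto simp: B_def J_def)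
      then show False using e ab that by (simp add: max_def min_def split: if_splits)
    qed
    ultimately show ?thesis
      using z[OF ab(2)] z[OF ab(3)] ab(1,4) i by (auto simp: f_def staircase_def)
  qed
  have sbm: "sbm n z' ?P = map_pmf \<phi> (Pi_pmf E False (\<lambda>e. bernoulli_pmf (f z' e)))" for z'
    by (simp add: sbm_def \<phi>_def E_def f_def case_prod_unfold)
  let ?G = "{X. h (\<phi> X) \<noteq> 1}"
  have "real (m choose t) * min (p ^ t * (1 - p) ^ (m - t)) (q ^ t * (1 - q) ^ (m - t))
      \<le> measure_pmf.prob (Pi_pmf E False (\<lambda>e. bernoulli_pmf (f z e))) ?G
        + measure_pmf.prob (Pi_pmf E False (\<lambda>e. bernoulli_pmf (f (z(i := 2)) e))) (- ?G)"
    unfolding cardB[symmetric]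
    by (rule bernoulli_testing_lower_bound[OF finE BE EB B1 B2]) (use pq in simp_all)
  also have "\<dots> \<le> measure_pmf.prob (sbm n z ?P) {A. h A \<noteq> 1}
      + measure_pmf.prob (sbm n (z(i := 2)) ?P) {A. h A \<noteq> 2}"
    unfolding sbm measure_map_pmf
    by (intro add_mono measure_pmf.finite_measure_mono) auto
  finally show ?thesis .
qed

lemma sum_Pow_split:
  fixes f :: "'a set \<Rightarrow> 'b :: comm_monoid_add"
  assumes "finite S" "i \<in> S"
  shows "(\<Sum>U\<in>Pow S. f U) = (\<Sum>U\<in>Pow (S - {i}). f U + f (insert i U))"
proof -
  have "Pow S = Pow (S - {i}) \<union> insert i ` Pow (S - {i})"
    using assms(2) by (metis Pow_insert insert_Diff)
  moreover have "inj_on (insert i) (Pow (S - {i}))" by (rule inj_onI) auto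
  ultimately show ?thesis
    using assms(1) by (simp add: sum.distrib) (subst sum.union_disjoint, auto simp: sum.reindex)
qed

text \<open>Makes every real function of the adjacency matrix integrable.\<close>

lemma finite_set_pmf_sbm: "finite (set_pmf (sbm n z P))"
proof -
  have "finite {(i, j). i \<in> {1..n} \<and> j \<in> {1..n} \<and> i > j}"
    by (rule finite_subset[of _ "{1..n} \<times> {1..n}"]) auto
  then show ?thesis unfolding sbm_def by (auto simp: set_Pi_pmf intro!: finite_PiE_dflt)
qed

text \<open>Averaging over all subsets: for each \<open>i\<close> the pairs \<open>U\<close>,
  \<open>insert i U\<close> partition the power set into \<open>2 ^ (card S - 1)\<close> pairs
  contributing at least \<open>v\<close> each. Hence the mean of the sum is at least
  \<open>card S * v / 2\<close>, and some subset reaches it.\<close>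

lemma ex_subset_sum_ge_average:
  fixes e :: "'a set \<Rightarrow> 'a \<Rightarrow> real"
  assumes fin: "finite S"
    and e: "\<And>i U. i \<in> S \<Longrightarrow> U \<subseteq> S - {i} \<Longrightarrow> v \<le> e U i + e (insert i U) i"
  obtains U where "U \<subseteq> S" "real (card S) * v / 2 \<le> (\<Sum>i\<in>S. e U i)"
proof (rule ccontr)
  assume "\<not> thesis"
  then have less: "(\<Sum>i\<in>S. e U i) < real (card S) * v / 2" if "U \<in> Pow S" for U
    using that by (meson PowD not_le_imp_less \<open>\<And>U. U \<subseteq> S \<Longrightarrow> real (card S) * v / 2 \<le> (\<Sum>i\<in>S. e U i) \<Longrightarrow> thesis\<close>)
  have "(\<Sum>U\<in>Pow S. \<Sum>i\<in>S. e U i) < (\<Sum>U\<in>Pow S. real (card S) * v / 2)"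
    using fin less by (intro sum_strict_mono) auto
  also have "\<dots> = 2 ^ card S * (real (card S) * v / 2)" using fin by (simp add: card_Pow)
  also have "\<dots> = (\<Sum>i\<in>S. \<Sum>U\<in>Pow (S - {i}). v)"
  proof -
    have "(\<Sum>U\<in>Pow (S - {i}). v) = 2 ^ card S * v / 2" if "i \<in> S" for i
    proof -
      have "card S = Suc (card (S - {i}))" using fin that by (rule card.remove[OF _ _, THEN trans]) simp
      then show ?thesis using fin by (simp add: card_Pow)
    qed
    then have "(\<Sum>i\<in>S. \<Sum>U\<in>Pow (S - {i}). v) = (\<Sum>i\<in>S. 2 ^ card S * v / 2)"
      by (rule sum.cong[OF refl])
    then show ?thesis by simp
  qed
  also have "\<dots> \<le> (\<Sum>i\<in>S. \<Sum>U\<in>Pow (S - {i}). e U i + e (insert i U) i)"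
    using e by (intro sum_mono) auto
  also have "\<dots> = (\<Sum>i\<in>S. \<Sum>U\<in>Pow S. e U i)" using fin by (simp add: sum_Pow_split)
  also have "\<dots> = (\<Sum>U\<in>Pow S. \<Sum>i\<in>S. e U i)" by (rule sum.swap)
  finally show False by simp
qed

text \<open>A pool of \<open>s\<close> nodes is taken from class \<open>1\<close>, and any subset of
  it may move to class \<open>2\<close>. Given an estimator, some subset makes the expected number
  of errors in the pool at least \<open>s / 2\<close> times the two-point bound. The inequalities on
  \<open>m\<close>, \<open>s\<close> and \<open>n\<close> keep all these labelings in the parameter
  class and leave enough known labels in each class.\<close>

lemma minimax_risk_ge:
  assumes K: "K \<ge> 3" and pq: "0 < q" "q < p" "p < 1" and p: "p \<le> 1 - \<epsilon>"
    and \<omega>: "\<omega>' \<le> p / q" "p / q \<le> \<omega>"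
    and D: "ereal D = chernoff (binomial_pmf m p) (binomial_pmf m q)"
    and m: "m > 0" "K * m \<le> n" and s: "3 * s \<le> m"
    and lower: "real n / (\<beta> * real K) \<le> real (m - s)"
    and upper: "real (m + s) \<le> \<beta> * real n / real K"
      "real (n - (K - 1) * m) \<le> \<beta> * real n / real K"
  shows "ereal (real s * (real (m choose t) *
        min (p ^ t * (1 - p) ^ (m - t)) (q ^ t * (1 - q) ^ (m - t))) / (2 * real n))
      \<le> minimax_risk n K (sbm_class \<beta> \<epsilon> \<omega> \<omega>' n p K D)"
proof -
  let ?P = "staircase K p q" and ?I = "{1..n}"
  define v where "v = real (m choose t) *
        min (p ^ t * (1 - p) ^ (m - t)) (q ^ t * (1 - q) ^ (m - t))"
  have "n > 0" using m K by (cases n) auto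
  obtain z0 where z0: "\<And>i. i \<in> ?I \<Longrightarrow> z0 i \<in> {1..K}"
    and z0_k: "\<And>k. k \<in> {2..K} \<Longrightarrow> card {i\<in>?I. z0 i = k} = m"
    and z0_1: "card {i\<in>?I. z0 i = (1::nat)} = n - (K - 1) * m"
    using balanced_labeling_exists[OF m(2)] K by auto
  have "m \<le> n - (K - 1) * m" using m K by (cases K) auto
  then have "s \<le> card {i\<in>?I. z0 i = 1}" using z0_1 s by simp
  then obtain S where S: "S \<subseteq> {i\<in>?I. z0 i = 1}" "card S = s" "finite S"
    by (rule obtain_subset_with_card_n)
  \<comment> \<open>Restricting to \<open>{1..n}\<close> makes the function extensional, as
    \<open>labelings\<close> demands.\<close>
  define zU where "zU = (\<lambda>U. \<lambda>i\<in>?I. if i \<in> U then 2 else z0 i)"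
  have labeling: "zU U \<in> labelings n K" for U
    using z0 K by (auto simp: labelings_def zU_def)
  have member: "(zU U, ?P) \<in> sbm_class \<beta> \<epsilon> \<omega> \<omega>' n p K D" if U: "U \<subseteq> S" for U
  proof -
    have finU: "finite U" and cardU: "card U \<le> s"
      using U S finite_subset card_mono by blast+
    have U1: "U \<subseteq> {i\<in>?I. z0 i = 1}" using U S(1) by blast
    have c1: "card {i\<in>?I. zU U i = 1} = n - (K - 1) * m - card U"
    proof -
      have "{i\<in>?I. zU U i = 1} = {i\<in>?I. z0 i = 1} - U" using U1 by (auto simp: zU_def)
      then show ?thesis using z0_1 finU U1 by (metis card_Diff_subset)
    qed
    have c2: "card {i\<in>?I. zU U i = 2} = m + card U"
    proof -
      have "{i\<in>?I. zU U i = 2} = {i\<in>?I. z0 i = 2} \<union> U" using U1 by (auto simp: zU_def)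
      moreover have "{i\<in>?I. z0 i = 2} \<inter> U = {}" using U1 by auto
      ultimately show ?thesis using z0_k[of 2] finU K by (simp add: card_Un_disjoint)
    qed
    have ck: "card {i\<in>?I. zU U i = k} = m" if k: "k \<in> {3..K}" for k
    proof -
      have "{i\<in>?I. zU U i = k} = {i\<in>?I. z0 i = k}" using U1 k by (auto simp: zU_def)
      then show ?thesis using z0_k[of k] k by simp
    qed
    have ge: "m \<le> card {i\<in>?I. zU U i = k}" if "k \<in> {2..K}" for k
    proof (cases "k = 2")
      case False
      then show ?thesis using ck[of k] that by auto
    qed (use c2 in simp)
    have sizes: "m - s \<le> card {i\<in>?I. zU U i = k} \<and>
        real (card {i\<in>?I. zU U i = k}) \<le> \<beta> * real n / real K" if k: "k \<in> {1..K}" for k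
    proof -
      consider "k = 1" | "k = 2" | "k \<in> {3..K}" using k by fastforce
      then show ?thesis
      proof cases
        case 1
        have "m - s \<le> n - (K - 1) * m - card U"
          using cardU \<open>m \<le> n - (K - 1) * m\<close> by simp
        moreover have "real (n - (K - 1) * m - card U) \<le> real (n - (K - 1) * m)" by simp
        ultimately show ?thesis using upper(2) unfolding 1 c1 by linarith
      next
        case 2
        have "real (m + card U) \<le> real (m + s)" using cardU by simp
        then show ?thesis using upper(1) unfolding 2 c2 by linarith
      next
        case 3
        have "real m \<le> real (m + s)" by simp
        then show ?thesis using upper(1) unfolding ck[OF 3] by linarith
      qed
    qed
    show ?thesis
      using K sizes ge by (intro staircase_mem_sbm_class[OF _ pq p \<omega> labeling _ _ _ D])
        (auto intro: order_trans[OF lower])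
  qed
  have "ereal (real s * v / (2 * real n)) \<le>
      (SUP (z, P)\<in>sbm_class \<beta> \<epsilon> \<omega> \<omega>' n p K D.
        ereal (measure_pmf.expectation (sbm n z P) (\<lambda>A. Mis n K (zhat A) z)))" for zhat
  proof -
    \<comment> \<open>The relabeling may depend on \<open>A\<close> but not on \<open>z\<close>, so
      composing it with \<open>zhat\<close> yields one test \<open>h\<close>, the same for all
      subsets \<open>U\<close>.\<close>
    have "\<exists>g. \<forall>z. (\<forall>i \<in> ?I - S. z i = z0 i) \<longrightarrow>
        (\<Sum>i\<in>S. of_bool (g (zhat A i) \<noteq> z i)) \<le> real n * Mis n K (zhat A) z" for A
    proof -
      have "2 * card S \<le> card {i \<in> ?I - S. z0 i = k}" if "k \<in> {1..K}" for k
      proof (cases "k = 1")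
        \<comment> \<open>Class \<open>1\<close> keeps at least \<open>m - s \<ge> 2 * s\<close>
          nodes outside the pool.\<close>
        case True
        have "{i \<in> ?I - S. z0 i = k} = {i \<in> ?I. z0 i = 1} - S" using True by auto
        then show ?thesis
          using S z0_1 s \<open>m \<le> n - (K - 1) * m\<close> by (simp add: card_Diff_subset)
      next
        case False
        then have "{i \<in> ?I - S. z0 i = k} = {i \<in> ?I. z0 i = k}" using S(1) by auto
        then show ?thesis using z0_k[of k] that False S(2) s by simp
      qed
      then show ?thesis
        using Mis_ge_hamming[of n S K z0 "zhat A"] \<open>n > 0\<close> S(1) by (smt (verit) mem_Collect_eq subset_iff)
    qed
    then obtain g where g: "\<And>A z. (\<forall>i \<in> ?I - S. z i = z0 i) \<Longrightarrow>
        (\<Sum>i\<in>S. of_bool (g A (zhat A i) \<noteq> z i)) \<le> real n * Mis n K (zhat A) z"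
      by metis
    define h where "h = (\<lambda>A i. g A (zhat A i))"
    define e where "e = (\<lambda>U i. measure_pmf.prob (sbm n (zU U) ?P) {A. h A i \<noteq> zU U i})"
    have "v \<le> e U i + e (insert i U) i" if i: "i \<in> S" and U: "U \<subseteq> S - {i}" for i U
    proof -
      have iI: "i \<in> ?I" "z0 i = 1" using i S(1) by auto
      have upd: "zU (insert i U) = (zU U)(i := 2)" using iI by (auto simp: zU_def)
      have "{j\<in>?I. zU U j = K} = {j\<in>?I. z0 j = K}"
        using K U S(1) by (auto simp: zU_def)
      then have "card {j\<in>?I. zU U j = K} = m" using z0_k[of K] K by simp
      moreover have "zU U i = 1" using iI U by (auto simp: zU_def)
      moreover have "zU U j \<in> {1..K}" if "j \<in> ?I" for j
        using labeling[of U] that by (auto simp: labelings_def)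
      ultimately show ?thesis
        using sbm_two_point_lower_bound[of K q p n "zU U" i m t "\<lambda>A. h A i"] K pq iI(1)
        unfolding e_def v_def upd by simp
    qed
    then obtain U where U: "U \<subseteq> S" and avg: "real (card S) * v / 2 \<le> (\<Sum>i\<in>S. e U i)"
      using ex_subset_sum_ge_average[OF S(3)] by blast
    let ?\<mu> = "measure_pmf (sbm n (zU U) ?P)"
    have int: "integrable ?\<mu> f" for f :: "_ \<Rightarrow> real"
      by (rule integrable_measure_pmf_finite[OF finite_set_pmf_sbm])
    have "e U i = measure_pmf.expectation (sbm n (zU U) ?P) (\<lambda>A. of_bool (h A i \<noteq> zU U i))" for i
    proof -
      have "(\<lambda>A. of_bool (h A i \<noteq> zU U i) :: real) = indicator {A. h A i \<noteq> zU U i}"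
        by (auto simp: indicator_def)
      then show ?thesis by (simp add: e_def)
    qed
    then have "(\<Sum>i\<in>S. e U i) = (\<integral>A. (\<Sum>i\<in>S. of_bool (h A i \<noteq> zU U i)) \<partial>?\<mu>)"
      using int by simp
    also have "\<dots> \<le> (\<integral>A. real n * Mis n K (zhat A) (zU U) \<partial>?\<mu>)"
    proof (rule integral_mono[OF int int])
      fix A
      show "(\<Sum>i\<in>S. of_bool (h A i \<noteq> zU U i)) \<le> real n * Mis n K (zhat A) (zU U)"
        unfolding h_def using U by (intro g) (auto simp: zU_def)
    qed
    also have "\<dots> = real n * (\<integral>A. Mis n K (zhat A) (zU U) \<partial>?\<mu>)" by simp
    finally have "real s * v / (2 * real n) \<le> (\<integral>A. Mis n K (zhat A) (zU U) \<partial>?\<mu>)"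
      using avg S(2) \<open>n > 0\<close> by (simp add: field_simps)
    then show ?thesis by (intro SUP_upper2[OF member[OF U]]) simp
  qed
  then show ?thesis unfolding minimax_risk_def v_def by (intro INF_greatest) simp
qed

section \<open>Choice of the constants and conclusion\<close>

theorem theorem3p1:
  fixes \<beta> \<epsilon> \<omega> \<omega>' :: real and Kstar :: nat
  assumes "\<beta> > 1" and "\<epsilon> \<in> {0<..<1}" and "\<omega> > 1" and "\<omega>' > 1" and "Kstar \<ge> 3"
  shows "\<exists>c C0 :: real. c > 0 \<and> C0 > 0 \<and>
    (\<forall>(n::nat) (K::nat) (pstar::real) (D::real).
       n > 0 \<and> 3 \<le> K \<and> K \<le> Kstar \<and> 0 < pstar \<and> pstar \<le> 1 - \<epsilon> \<and> real n * pstar \<ge> C0 \<and>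
       (\<exists>q. 0 < q \<and> q < pstar \<and> \<omega>' \<le> pstar / q \<and> pstar / q \<le> \<omega> \<and>
            ereal D = chernoff (binomial_pmf (n div K) pstar) (binomial_pmf (n div K) q))
       \<longrightarrow> minimax_risk n K (sbm_class \<beta> \<epsilon> \<omega> \<omega>' n pstar K D)
             \<ge> ereal (c / sqrt (real n * pstar) * exp (- D)))"
proof -
  \<comment> \<open>The pool takes about a fraction \<delta> of \<open>m\<close>. The first bound
    gives \<open>3 * s \<le> m\<close>, the second preserves the balance condition with constant
    \<beta>.\<close>
  define \<delta> where "\<delta> = min (1 / 3) ((\<beta> - 1) / (2 * \<beta>))"
  have \<delta>: "0 < \<delta>" "3 * \<delta> \<le> 1" "2 * (\<beta> * \<delta>) \<le> \<beta> - 1"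
    using assms(1) by (auto simp: \<delta>_def min_def field_simps)
  \<comment> \<open>A lower bound for \<open>m\<close>: the first summand lets the floor of
    \<open>\<delta> * m\<close> lose at most half, the second lets \<open>(\<beta> - 1) * m\<close>
    absorb the rounding in \<open>n div K\<close>.\<close>
  define M where "M = 2 / \<delta> + (real Kstar + 2) / (\<beta> - 1)"
  have M: "M > 0" using \<delta>(1) assms(1) by (auto simp: M_def intro!: add_pos_pos)
  \<comment> \<open>Since \<open>p < 1\<close>, the condition on \<open>n * p\<close> also bounds
    \<open>n\<close> from below, which forces \<open>m > M\<close>.\<close>
  define C0 where "C0 = real Kstar * (M + 1) + 1"
  \<comment> \<open>In order: the lower bound for \<open>s / n\<close>, the factor from averaging,
    the constant of the mode bound after \<open>4 * (4 * r + 1) \<le> 20 * r\<close>, and the lower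
    bound for the inverse odds ratio.\<close>
  define c where "c = \<delta> / (4 * real Kstar) / 2 * (3 / 20) * (\<epsilon> / \<omega>)"
  have "c > 0" using \<delta>(1) assms by (auto simp: c_def)
  moreover have "C0 > 0" using M by (auto simp: C0_def intro!: add_nonneg_pos)
  moreover have "ereal (c / sqrt (real n * p) * exp (- D))
      \<le> minimax_risk n K (sbm_class \<beta> \<epsilon> \<omega> \<omega>' n p K D)"
    if n: "n > 0" and K: "3 \<le> K" "K \<le> Kstar" and p: "0 < p" "p \<le> 1 - \<epsilon>"
      and np: "real n * p \<ge> C0" and q: "0 < q" "q < p" "\<omega>' \<le> p / q" "p / q \<le> \<omega>"
      and D: "ereal D = chernoff (binomial_pmf (n div K) p) (binomial_pmf (n div K) q)"
    for n K :: nat and p D q :: real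
  proof -
    define m where "m = n div K"
    have p1: "p < 1" using p assms(2) by auto
    have "K * m \<le> n" and n_less: "n < K * (m + 1)"
      using K unfolding m_def by (simp_all add: dividend_less_times_div)
    have Km: "real K * real m \<le> real n" "real n \<le> real K * (real m + 1)"
      using of_nat_mono[OF \<open>K * m \<le> n\<close>, where ?'a = real]
        of_nat_mono[OF less_imp_le[OF n_less], where ?'a = real]
      by (simp_all add: algebra_simps)
    have "real n * p \<le> real n" using p1 by (simp add: mult_left_le)
    then have "real Kstar * (M + 1) < real n" using np by (simp add: C0_def)
    also have "\<dots> \<le> real Kstar * (real m + 1)"
      using K(2) by (intro order_trans[OF Km(2)] mult_right_mono) auto
    finally have "M < m" using K by simp
    then have m1: "2 / \<delta> \<le> m" and m2: "(real Kstar + 2) / (\<beta> - 1) \<le> m"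
    proof -
      have "2 / \<delta> \<ge> 0" "(real Kstar + 2) / (\<beta> - 1) \<ge> 0" using \<delta>(1) assms(1) by auto
      then show "2 / \<delta> \<le> m" "(real Kstar + 2) / (\<beta> - 1) \<le> m"
        using \<open>M < m\<close> unfolding M_def by linarith+
    qed
    have m_\<delta>: "2 \<le> \<delta> * m" using m1 \<delta>(1) by (simp add: field_simps)
    have m_\<beta>: "real Kstar + 2 \<le> (\<beta> - 1) * m" using m2 assms(1) by (simp add: field_simps)
    have m_pos: "m > 0" using \<open>M < m\<close> M by linarith
    define s where "s = nat \<lfloor>\<delta> * m\<rfloor>"
    have s: "real s \<le> \<delta> * m" "\<delta> * m / 2 \<le> real s" using m_\<delta> unfolding s_def by linarith+
    have s3: "3 * s \<le> m"
    proof -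
      have "3 * real s \<le> 3 * \<delta> * m" using s by simp
      also have "\<dots> \<le> 1 * real m" using \<delta>(2) by (intro mult_right_mono) auto
      finally show ?thesis by linarith
    qed
    have \<beta>s: "2 * (\<beta> * s) \<le> (\<beta> - 1) * m"
    proof -
      have "2 * (\<beta> * s) \<le> 2 * (\<beta> * (\<delta> * m))" using s assms(1) by simp
      also have "\<dots> \<le> (\<beta> - 1) * m" using mult_right_mono[OF \<delta>(3), of "real m"] by (simp add: mult_ac)
      finally show ?thesis .
    qed
    have s_\<beta>: "real s \<le> \<beta> * s" using assms(1) mult_right_mono[of 1 \<beta> "real s"] by simp
    have "real n \<le> real K * (\<beta> * (m - s))"
    proof -
      \<comment> \<open>One half of \<open>(\<beta> - 1) * m\<close> pays for the pool, the other
        for the summand 1.\<close>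
      have "real m + 1 \<le> \<beta> * (real m - real s)"
        using \<beta>s m_\<beta> by (simp add: algebra_simps)
      then have "real K * (real m + 1) \<le> real K * (\<beta> * (real m - real s))"
        by (intro mult_left_mono) auto
      moreover have "real (m - s) = real m - real s" using s3 by simp
      ultimately show ?thesis using Km(2) by simp
    qed
    then have lower: "real n / (\<beta> * real K) \<le> real (m - s)"
      using assms(1) K by (simp add: field_simps)
    have \<beta>m: "\<beta> * m \<le> \<beta> * real n / real K"
      using Km(1) K assms(1) by (simp add: field_simps)
    have "real (m + s) \<le> \<beta> * m" using \<beta>s s_\<beta> by (simp add: algebra_simps)
    then have upper1: "real (m + s) \<le> \<beta> * real n / real K" using \<beta>m by linarith
    \<comment> \<open>Class \<open>1\<close> exceeds \<open>m\<close> only by the remainder of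
      \<open>n\<close> modulo \<open>K\<close>.\<close>
    have "n - (K - 1) * m \<le> m + K"
      using n_less K by (cases K) (auto simp: algebra_simps)
    then have "real (n - (K - 1) * m) \<le> real m + real Kstar" using K by linarith
    also have "\<dots> \<le> \<beta> * m" using m_\<beta> by (simp add: algebra_simps)
    finally have upper2: "real (n - (K - 1) * m) \<le> \<beta> * real n / real K" using \<beta>m by linarith
    \<comment> \<open>Takes the place of the deviation bound \<open>s\<close> in
      \<open>binomial_overlap\<close>, as \<open>m * p \<le> n * p\<close>.\<close>
    define r where "r = sqrt (real n * p)"
    have np1: "1 \<le> real n * p"
    proof -
      have "0 \<le> real Kstar * (M + 1)" using M by simp
      then show ?thesis using np unfolding C0_def by linarith
    qed
    then have r: "r \<ge> 1" "r\<^sup>2 = real n * p" using n p by (auto simp: r_def)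
    have "real m \<le> real n" by (simp add: m_def)
    then have mp: "real m * p \<le> r\<^sup>2" unfolding r(2) using p by (simp add: mult_right_mono)
    obtain \<alpha> t where \<alpha>: "0 < \<alpha>" "\<alpha> < 1" and "t \<le> m"
      and V: "real (m choose t) * min (p ^ t * (1 - p) ^ (m - t)) (q ^ t * (1 - q) ^ (m - t))
        \<ge> 3 / (4 * (4 * r + 1)) * (q * (1 - p) / (p * (1 - q))) * bernoulli_affinity \<alpha> p q ^ m"
      using binomial_overlap[of q p r m] q p1 r mp by auto
    define V where "V = real (m choose t) * min (p ^ t * (1 - p) ^ (m - t)) (q ^ t * (1 - q) ^ (m - t))"
    have "3 / (20 * r) \<le> 3 / (4 * (4 * r + 1))" using r(1) by (simp add: field_simps)
    moreover have "\<epsilon> / \<omega> \<le> q * (1 - p) / (p * (1 - q))"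
    proof -
      \<comment> \<open>Uses \<open>1 - p \<ge> \<epsilon>\<close> and
        \<open>p / q \<le> \<omega>\<close>; the denominator \<open>1 - q\<close> below 1 only
        helps.\<close>
      have "\<epsilon> / \<omega> \<le> (1 - p) / (p / q)"
        using assms q p by (intro frac_le) auto
      also have "\<dots> = q * (1 - p) / p" by simp
      also have "\<dots> \<le> q * (1 - p) / (p * (1 - q))"
        using q p1 by (intro divide_left_mono) auto
      finally show ?thesis .
    qed
    moreover have "exp (- D) \<le> bernoulli_affinity \<alpha> p q ^ m"
      using D q p1 \<alpha> unfolding m_def by (intro exp_minus_chernoff_binomial_le) auto
    ultimately have "3 / (20 * r) * (\<epsilon> / \<omega>) * exp (- D)
        \<le> 3 / (4 * (4 * r + 1)) * (q * (1 - p) / (p * (1 - q))) * bernoulli_affinity \<alpha> p q ^ m"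
      using r(1) q p1 assms by (intro mult_mono mult_nonneg_nonneg) auto
    then have V': "3 / (20 * r) * (\<epsilon> / \<omega>) * exp (- D) \<le> V" using V unfolding V_def by linarith
    have sn: "\<delta> / (4 * real Kstar) \<le> real s / real n"
    proof -
      have "real n \<le> real K * (2 * real m)"
        using Km(2) m_pos by (elim order_trans) (intro mult_left_mono, auto)
      also have "\<dots> \<le> real Kstar * (2 * real m)" using K by (intro mult_right_mono) auto
      finally have "\<delta> * real n \<le> \<delta> * (real Kstar * (2 * real m))"
        using \<delta>(1) by simp
      also have "\<dots> = 4 * real Kstar * (\<delta> * m / 2)" by simp
      also have "\<dots> \<le> 4 * real Kstar * real s" using s(2) by (intro mult_left_mono) auto
      finally show ?thesis using n K by (simp add: field_simps)
    qed
    have "c / r * exp (- D) = \<delta> / (4 * real Kstar) / 2 * (3 / (20 * r) * (\<epsilon> / \<omega>) * exp (- D))"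
      by (simp add: c_def mult_ac)
    also have "\<dots> \<le> real s / real n / 2 * V"
      using sn V' \<delta>(1) r(1) assms by (intro mult_mono divide_right_mono mult_nonneg_nonneg) auto
    also have "\<dots> = real s * V / (2 * real n)" by simp
    finally have "ereal (c / r * exp (- D)) \<le> ereal (real s * V / (2 * real n))" by simp
    also have "\<dots> \<le> minimax_risk n K (sbm_class \<beta> \<epsilon> \<omega> \<omega>' n p K D)"
      unfolding V_def
      by (rule minimax_risk_ge[OF K(1) q(1,2) p1 p(2) q(3,4) _ m_pos \<open>K * m \<le> n\<close> s3 lower upper1 upper2])
        (use D m_def in simp)
    finally show ?thesis unfolding r_def .
  qed
  ultimately show ?thesis by blast
qed

end
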